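(* Let $p$ be a prime and let $\Psi$ be a system of $t$ linear forms over $\mathbb{F}_p$ whose image is described by two linear equations (i.e. $\operatorname{Im}\Psi=\ker M$ for a $2\times t$ matrix $M$ of rank two), and suppose $\Psi$ is linearly generic. Then $\Psi$ is not locally Sidorenko.
   Context: A system of linear forms $\Psi=(\psi_1,\ldots,\psi_t)$ consists of $\mathbb{F}_p$-linear maps $\psi_i:\mathbb{F}_p^D\to\mathbb{F}_p$ (with $D\le t$ and $x\mapsto(\psi_1(x),\ldots,\psi_t(x))$ injective), also acting $(\mathbb{F}_p^n)^D\to\mathbb{F}_p^n$ by the same formula; $\operatorname{Im}\Psi=\{(\psi_i(x))_{i=1}^t:x\in\mathbb{F}_p^D\}$. For $f:\mathbb{F}_p^n\to\mathbb{C}$, $T_\Psi(f)=p^{-nD}\sum_{x\in(\mathbb{F}_p^n)^D}\prod_{i=1}^tf(\psi_i(x))$. $\Psi$ is locally Sidorenko if for every $\alpha\in[0,1]$ there is $\varepsilon>0$ such that for all $n\ge1$ and all $f:\mathbb{F}_p^n\to[-\alpha,1-\alpha]$ with $\mathbb{E}_xf(x)=0$, $T_\Psi(\alpha+\varepsilon f)\ge\alpha^t$. $\Psi$ is linearly generic if every $2\times2$ minor of $M$ has nonzero determinant.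
   Formalization: For t = 3 it is additionally assumed that the three linear forms are not all equal; otherwise the claim fails, since Ψ = (x,x,x) is linearly generic but E g³ ≥ (E g)³ for g ≥ 0 makes it locally Sidorenko. *)

theory Defs
  imports
    Complex_Main
    "HOL-Library.FuncSet"
    "Berlekamp_Zassenhaus.Finite_Field"
    "Jordan_Normal_Form.DL_Rank"
    "Jordan_Normal_Form.Matrix_Kernel"
begin

(* The field F_p is 'p mod_ring for a type 'p of prime cardinality p (class prime_card), and F_p^n is
   carrier_vec n.  A system of t linear forms on F_p^D is given by its t x D coefficient matrix
   Psi: the form psi_i (0 <= i < t) is x \<mapsto> row Psi i \<bullet> x, so x \<mapsto> (psi_1(x),...,psi_t(x)) is
   x \<mapsto> Psi *\<^sub>v x.  D = 0 is
   allowed. *)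

definition linear_form_system :: "nat \<Rightarrow> nat \<Rightarrow> 'a::field mat \<Rightarrow> bool" where
  "linear_form_system D t Psi \<longleftrightarrow>
     Psi \<in> carrier_mat t D \<and> D \<le> t \<and> inj_on (\<lambda>x. Psi *\<^sub>v x) (carrier_vec D)"

definition Im_system :: "'a::field mat \<Rightarrow> 'a vec set" where
  "Im_system Psi = (\<lambda>x. Psi *\<^sub>v x) ` carrier_vec (dim_col Psi)"

(* The form psi_i acting (F_p^n)^D \<rightarrow> F_p^n, with x = (x_0,...,x_(D-1)) given as a family of vectors. *)
definition form_action :: "'a::field mat \<Rightarrow> nat \<Rightarrow> nat \<Rightarrow> (nat \<Rightarrow> 'a vec) \<Rightarrow> 'a vec" where
  "form_action Psi n i x = vec n (\<lambda>k. \<Sum>j<dim_col Psi. Psi $$ (i, j) * (x j $ k))"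

(* Values are taken in any field of characteristic 0, so that the same functional applies to
   complex-valued functions and to the real-valued ones in the local Sidorenko property. *)
definition T_system ::
  "'p::prime_card mod_ring mat \<Rightarrow> nat \<Rightarrow> ('p mod_ring vec \<Rightarrow> 'b::field_char_0) \<Rightarrow> 'b" where
  "T_system Psi n f =
     (\<Sum>x \<in> {..<dim_col Psi} \<rightarrow>\<^sub>E carrier_vec n. \<Prod>i<dim_row Psi. f (form_action Psi n i x))
       / of_nat (CARD('p) ^ (n * dim_col Psi))"

definition expectation_vec ::
  "nat \<Rightarrow> ('p::prime_card mod_ring vec \<Rightarrow> 'b::field_char_0) \<Rightarrow> 'b" where
  "expectation_vec n f = (\<Sum>x \<in> carrier_vec n. f x) / of_nat (CARD('p) ^ n)"

definition locally_Sidorenko :: "'p::prime_card mod_ring mat \<Rightarrow> bool" where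
  "locally_Sidorenko Psi \<longleftrightarrow>
     (\<forall>\<alpha>::real. 0 \<le> \<alpha> \<and> \<alpha> \<le> 1 \<longrightarrow>
       (\<exists>\<epsilon>>0. \<forall>n\<ge>1. \<forall>f \<in> carrier_vec n \<rightarrow> {-\<alpha>..1 - \<alpha>}.
          expectation_vec n f = 0 \<longrightarrow> T_system Psi n (\<lambda>x. \<alpha> + \<epsilon> * f x) \<ge> \<alpha> ^ dim_row Psi))"

definition linearly_generic :: "'a::field mat \<Rightarrow> bool" where
  "linearly_generic M \<longleftrightarrow>
     (\<forall>i j. i < j \<and> j < dim_col M \<longrightarrow> det (mat_of_cols 2 [col M i, col M j]) \<noteq> 0)"

end

(* Any t - 2 of the forms are independent, so for f of mean zero the multilinear expansion of
   T(1/2 + eps f) has, apart from 2^(-t), only the terms with t - 1 and t factors f.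
   For even t the terms with t - 1 factors are odd in f, and a negative multiple of the centred
   indicator of 0 makes their sum negative.  For t = 3 the image is a line and f is supported on two
   points.  For odd t >= 5 take f = -(p 1_Q - 1) for the hyperbolic quadric Q = {(u, v) : u . v = 0}.
   Expanded in the characters of l * (u . v), l <> 0, the sums count tuples of vectors u subject
   to linear conditions.  The counts with t - 1 factors are at most p^m.  Some count with t factors is
   of order p^(2m), because there are nonzero weights mu with
   sum mu a^2 = sum mu a b = sum mu b^2 = 0 over the columns (a, b) of M.  These weights come from a
   divided difference, after moving a slope missed by the columns to infinity; one is missed because
   t is odd and so t < p + 1.  Hence the full term dominates as m grows, however small eps is. *)
theory Submission
  imports Defs
begin

section \<open>Solutions of a generic pair of equations\<close>

text \<open>For odd t the terms with t - 1 factors are even in f, so changing the sign of f does not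
  affect them, and the full term carries one more power of eps. A fixed f for which those terms have
  a positive sum fails once eps is small. So f is taken from a family in which the ratio of the full
  term to the others is unbounded; the dimension may grow with 1/eps because eps is chosen before n.

  The quadric gives such a family. In the expansion of a product over an index set S, summation over
  v leaves the tuples u for which the sum over S of l_i (u_i . v_i) vanishes at every solution v.
  This means l_i u_i = a_i r + b_i s for i in S and a_i r + b_i s = 0 for i outside S, for some r
  and s. If one index is missing, its equation ties r to s and about p^m choices remain. If none is
  missing, the only restriction on (r, s) is that u be a solution itself; it holds identically when
  the weights 1/l_i kill the three quadratic moments, and p^(2m) choices remain. At least four
  distinct points are needed for nonzero weights orthogonal to 1, x and x^2, so t = 3 has to be
  treated separately.\<close>

lemma bij_betw_carrier_vec:
  "bij_betw (\<lambda>g. vec n g) ({..<n} \<rightarrow>\<^sub>E (UNIV :: 'a set)) (carrier_vec n)"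
proof (rule bij_betw_byWitness[where f' = "\<lambda>v. \<lambda>k\<in>{..<n}. v $ k"])
  show "\<forall>g\<in>{..<n} \<rightarrow>\<^sub>E UNIV. (\<lambda>k\<in>{..<n}. vec n g $ k) = g"
    by (force simp: PiE_iff extensional_def restrict_def fun_eq_iff)
  show "\<forall>v\<in>carrier_vec n. vec n (\<lambda>k\<in>{..<n}. v $ k) = (v :: 'a vec)"
  proof
    fix v :: "'a vec" assume "v \<in> carrier_vec n"
    then show "vec n (\<lambda>k\<in>{..<n}. v $ k) = v" by (intro eq_vecI) auto
  qed
  show "vec n ` ({..<n} \<rightarrow>\<^sub>E UNIV) \<subseteq> carrier_vec n"
    by (intro image_subsetI vec_carrier)
  show "(\<lambda>v. \<lambda>k\<in>{..<n}. v $ k) ` carrier_vec n \<subseteq> {..<n} \<rightarrow>\<^sub>E (UNIV :: 'a set)"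
    by (intro image_subsetI restrict_PiE_iff[THEN iffD2]) simp
qed

lemma finite_carrier_vec [simp, intro]: "finite (carrier_vec n :: 'a::finite vec set)"
  using bij_betw_finite[OF bij_betw_carrier_vec[of n, where 'a = 'a]] by (simp add: finite_PiE)

lemma card_carrier_vec: "card (carrier_vec n :: 'a::finite vec set) = CARD('a) ^ n"
  using bij_betw_same_card[OF bij_betw_carrier_vec[of n, where 'a = 'a]]
  by (simp add: card_PiE)

text \<open>\<open>A\<close> and \<open>B\<close> stand for the contribution of the other
  coordinates. The equivalence yields existence and uniqueness of the two solved coordinates at
  once.\<close>

lemma cramer2:
  fixes a1 a2 b1 b2 :: "'a::field"
  assumes "a1 * b2 - a2 * b1 \<noteq> 0"
  shows "a1 * x + a2 * y + A = 0 \<and> b1 * x + b2 * y + B = 0 \<longleftrightarrow>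
    x = (a2 * B - b2 * A) / (a1 * b2 - a2 * b1) \<and> y = (b1 * A - a1 * B) / (a1 * b2 - a2 * b1)"
    (is "?L \<longleftrightarrow> ?R")
proof
  assume L: ?L
  then have A: "A = - (a1 * x + a2 * y)" and B: "B = - (b1 * x + b2 * y)"
    using minus_unique by metis+
  show ?R
    using assms unfolding A B by (simp add: nonzero_eq_divide_eq algebra_simps)
next
  assume ?R
  then have x: "x * (a1 * b2 - a2 * b1) = a2 * B - b2 * A"
    and y: "y * (a1 * b2 - a2 * b1) = b1 * A - a1 * B"
    using assms by simp_all
  have "(a1 * b2 - a2 * b1) * (a1 * x + a2 * y + A) =
      a1 * (x * (a1 * b2 - a2 * b1)) + a2 * (y * (a1 * b2 - a2 * b1)) + (a1 * b2 - a2 * b1) * A"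
    by (simp add: algebra_simps)
  moreover have "(a1 * b2 - a2 * b1) * (b1 * x + b2 * y + B) =
      b1 * (x * (a1 * b2 - a2 * b1)) + b2 * (y * (a1 * b2 - a2 * b1)) + (a1 * b2 - a2 * b1) * B"
    by (simp add: algebra_simps)
  ultimately have "(a1 * b2 - a2 * b1) * (a1 * x + a2 * y + A) = 0"
    "(a1 * b2 - a2 * b1) * (b1 * x + b2 * y + B) = 0"
    unfolding x y by (simp_all add: algebra_simps)
  then show ?L
    using assms by simp
qed

text \<open>The columns \<open>(a i, b i)\<close> are pairwise non-proportional, that is, for t at
  least 2, distinct points of the projective line.\<close>

locale generic_equation_pair =
  fixes a b :: "nat \<Rightarrow> 'a::{finite,field}" and t :: nat
  assumes minor: "i < t \<Longrightarrow> j < t \<Longrightarrow> i \<noteq> j \<Longrightarrow> a i * b j - a j * b i \<noteq> 0"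
begin

definition sol :: "nat \<Rightarrow> (nat \<Rightarrow> 'a vec) set" where
  "sol n = {Y \<in> {..<t} \<rightarrow>\<^sub>E carrier_vec n.
     \<forall>k<n. (\<Sum>i<t. a i * (Y i $ k)) = 0 \<and> (\<Sum>i<t. b i * (Y i $ k)) = 0}"

lemma finite_sol [simp, intro]: "finite (sol n)"
  unfolding sol_def by (rule finite_subset[of _ "{..<t} \<rightarrow>\<^sub>E carrier_vec n"]) (auto intro: finite_PiE)

lemma sol_carrier: "Y \<in> sol n \<Longrightarrow> i < t \<Longrightarrow> Y i \<in> carrier_vec n"
  by (auto simp: sol_def PiE_iff)

text \<open>The minor of columns i and j is invertible, so Cramer's rule recovers coordinates i and
  j from the rest. Hence any t - 2 coordinates of a solution are free.\<close>

lemma bij_betw_restrict_sol: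
  assumes ij: "i < t" "j < t" "i \<noteq> j"
  defines "R \<equiv> {..<t} - {i, j}"
  shows "bij_betw (\<lambda>Y. restrict Y R) (sol n) (R \<rightarrow>\<^sub>E carrier_vec n)"
proof -
  define d where "d = a i * b j - a j * b i"
  have d: "d \<noteq> 0" using minor ij by (simp add: d_def)
  define P where "P Z = vec n (\<lambda>k. (a j * (\<Sum>l\<in>R. b l * (Z l $ k)) - b j * (\<Sum>l\<in>R. a l * (Z l $ k))) / d)"
    for Z :: "nat \<Rightarrow> 'a vec"
  define Q where "Q Z = vec n (\<lambda>k. (b i * (\<Sum>l\<in>R. a l * (Z l $ k)) - a i * (\<Sum>l\<in>R. b l * (Z l $ k))) / d)"
    for Z :: "nat \<Rightarrow> 'a vec"
  have split: "(\<Sum>l<t. h l) = h i + h j + (\<Sum>l\<in>R. h l)" for h :: "nat \<Rightarrow> 'a"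
  proof -
    have "{..<t} = insert i (insert j R)" "i \<notin> insert j R" "j \<notin> R" "finite R"
      using ij by (auto simp: R_def)
    then show ?thesis by (simp add: add.assoc)
  qed
  have iff: "Y \<in> sol n \<longleftrightarrow> Y i = P Y \<and> Y j = Q Y" if "Y \<in> {..<t} \<rightarrow>\<^sub>E carrier_vec n" for Y
  proof -
    have "Y \<in> sol n \<longleftrightarrow> (\<forall>k<n. Y i $ k = P Y $ k \<and> Y j $ k = Q Y $ k)"
      using that cramer2[OF d[unfolded d_def]]
      unfolding sol_def split by (simp add: P_def Q_def d_def)
    also have "\<dots> \<longleftrightarrow> Y i = P Y \<and> Y j = Q Y"
      using PiE_mem[OF that, of i] PiE_mem[OF that, of j] ij
      by (auto simp: P_def Q_def)
    finally show ?thesis .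
  qed
  have PR: "P (restrict Y R) = P Y" "Q (restrict Y R) = Q Y" for Y
    by (auto simp: P_def Q_def)
  define g where "g Z = (\<lambda>l\<in>{..<t}. if l = i then P Z else if l = j then Q Z else Z l)" for Z
  have "(\<Sum>l\<in>R. h l * (g Z l $ k)) = (\<Sum>l\<in>R. h l * (Z l $ k))" for h Z k
    by (rule sum.cong) (auto simp: g_def R_def)
  then have g: "P (g Z) = P Z" "Q (g Z) = Q Z" for Z
    by (simp_all add: P_def Q_def)
  have gij: "g Z i = P Z" "g Z j = Q Z" for Z
    using ij by (simp_all add: g_def)
  have PQ: "P Z \<in> carrier_vec n" "Q Z \<in> carrier_vec n" for Z
    by (auto simp: P_def Q_def)
  show ?thesis
  proof (rule bij_betw_byWitness[where f' = g])
    show "\<forall>Y\<in>sol n. g (restrict Y R) = Y"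
    proof
      fix Y assume Y: "Y \<in> sol n"
      then have E: "Y \<in> {..<t} \<rightarrow>\<^sub>E carrier_vec n" by (simp add: sol_def)
      show "g (restrict Y R) = Y"
      proof
        fix l show "g (restrict Y R) l = Y l"
          using iff[OF E] Y PiE_arb[OF E, of l]
          PR[of Y, unfolded R_def]
          by (cases "l < t") (auto simp: g_def R_def)
      qed
    qed
    show "\<forall>Z\<in>R \<rightarrow>\<^sub>E carrier_vec n. restrict (g Z) R = Z"
    proof
      fix Z :: "nat \<Rightarrow> 'a vec" assume Z: "Z \<in> R \<rightarrow>\<^sub>E carrier_vec n"
      have "restrict (g Z) R = restrict Z R" by (rule restrict_ext) (auto simp: g_def R_def)
      then show "restrict (g Z) R = Z" using PiE_restrict[OF Z] by simp
    qed
    show "(\<lambda>Y. restrict Y R) ` sol n \<subseteq> R \<rightarrow>\<^sub>E carrier_vec n"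
      using sol_carrier unfolding R_def by (intro image_subsetI restrict_PiE_iff[THEN iffD2]) auto
    show "g ` (R \<rightarrow>\<^sub>E carrier_vec n) \<subseteq> sol n"
    proof
      fix Y assume "Y \<in> g ` (R \<rightarrow>\<^sub>E carrier_vec n)"
      then obtain Z where Z: "Z \<in> R \<rightarrow>\<^sub>E carrier_vec n" "Y = g Z" by auto
      have "g Z \<in> {..<t} \<rightarrow>\<^sub>E carrier_vec n"
        using Z(1) PQ[of Z] by (auto simp: g_def R_def PiE_iff)
      then show "Y \<in> sol n" using iff g gij Z(2) by simp
    qed
  qed
qed

section \<open>Independence of few coordinates and the multilinear expansion\<close>

lemma ex_indices_outside:
  assumes "S \<subseteq> {..<t}" "card S \<le> t - 2" "t \<ge> 2"
  obtains i j where "i < t" "j < t" "i \<noteq> j" "S \<subseteq> {..<t} - {i, j}"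
proof -
  have "card ({..<t} - S) = t - card S"
    using assms(1) by (simp add: card_Diff_subset finite_subset)
  then have "card ({..<t} - S) \<ge> 2" using assms(2,3) by linarith
  then obtain T where T: "T \<subseteq> {..<t} - S" "card T = 2"
    using obtain_subset_with_card_n by metis
  then obtain i j where "T = {i, j}" "i \<noteq> j" by (auto simp: card_2_iff)
  then show ?thesis using that[of i j] T(1) assms(1) by auto
qed

text \<open>Two indices outside S can be solved for. The remaining t - 2 coordinates range freely,
  so the sum factorises over them, and each of those not in S contributes the size of the
  space.\<close>

lemma sum_sol_prod_subset:
  fixes g :: "'a vec \<Rightarrow> 'c::comm_semiring_1"
  assumes S: "S \<subseteq> {..<t}" "card S \<le> t - 2" and t: "t \<ge> 2"
  shows "(\<Sum>Y\<in>sol n. \<Prod>l\<in>S. g (Y l)) =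
    (\<Sum>x\<in>carrier_vec n. g x) ^ card S * of_nat (CARD('a) ^ n) ^ (t - 2 - card S)"
proof -
  obtain i j where ij: "i < t" "j < t" "i \<noteq> j" "S \<subseteq> {..<t} - {i, j}"
    by (rule ex_indices_outside[OF S t])
  define R where "R = {..<t} - {i, j}"
  have R: "finite R" "S \<subseteq> R" "card R = t - 2" using ij by (auto simp: R_def card_Diff_subset)
  \<comment> \<open>Padding with ones extends the product from S to all free indices, as
    \<open>prod_sum_PiE\<close> requires.\<close>
  define h where "h l x = (if l \<in> S then g x else 1)" for l and x :: "'a vec"
  have hS: "(\<Prod>l\<in>R. if l \<in> S then u l else v) = prod u S * v ^ (t - 2 - card S)"
    for u :: "nat \<Rightarrow> 'c" and v
  proof -
    have "(\<Prod>l\<in>R. if l \<in> S then u l else v) =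
        (\<Prod>l\<in>R - S. if l \<in> S then u l else v) * (\<Prod>l\<in>S. if l \<in> S then u l else v)"
      by (rule prod.subset_diff) (use R in auto)
    also have "\<dots> = prod u S * v ^ card (R - S)"
    proof -
      have "(\<Prod>l\<in>R - S. if l \<in> S then u l else v) = (\<Prod>l\<in>R - S. v)"
        by (rule prod.cong) auto
      then show ?thesis by (simp add: mult.commute)
    qed
    also have "card (R - S) = t - 2 - card S"
      using R by (simp add: card_Diff_subset finite_subset)
    finally show ?thesis .
  qed
  have "(\<Sum>Y\<in>sol n. \<Prod>l\<in>S. g (Y l)) = (\<Sum>Y\<in>sol n. \<Prod>l\<in>R. h l (restrict Y R l))"
  proof (rule sum.cong[OF refl])
    fix Y assume "Y \<in> sol n"
    have "(\<Prod>l\<in>R. h l (restrict Y R l)) = (\<Prod>l\<in>R. if l \<in> S then g (Y l) else 1)"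
      by (rule prod.cong) (auto simp: h_def)
    then show "(\<Prod>l\<in>S. g (Y l)) = (\<Prod>l\<in>R. h l (restrict Y R l))"
      using hS[of "\<lambda>l. g (Y l)" 1] by simp
  qed
  also have "\<dots> = (\<Sum>Z\<in>R \<rightarrow>\<^sub>E carrier_vec n. \<Prod>l\<in>R. h l (Z l))"
    unfolding R_def by (rule sum.reindex_bij_betw[OF bij_betw_restrict_sol[OF ij(1-3)]])
  also have "\<dots> = (\<Prod>l\<in>R. \<Sum>x\<in>carrier_vec n. h l x)"
    using R by (subst prod_sum_PiE) auto
  also have "\<dots> = (\<Prod>l\<in>R. if l \<in> S then \<Sum>x\<in>carrier_vec n. g x else of_nat (CARD('a) ^ n))"
    by (intro prod.cong refl) (simp add: h_def card_carrier_vec)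
  also have "\<dots> = (\<Sum>x\<in>carrier_vec n. g x) ^ card S * of_nat (CARD('a) ^ n) ^ (t - 2 - card S)"
    by (simp only: hS prod_constant)
  finally show ?thesis .
qed

lemma card_sol: "t \<ge> 2 \<Longrightarrow> card (sol n) = (CARD('a) ^ n) ^ (t - 2)"
  using sum_sol_prod_subset[where S = "{}" and n = n and g = "\<lambda>_. 1::nat"] by simp

lemma sol_eqI:
  assumes Y: "Y \<in> sol n" "Z \<in> sol n" and ij: "i < t" "j < t" "i \<noteq> j"
    and eq: "\<And>l. l < t \<Longrightarrow> l \<noteq> i \<Longrightarrow> l \<noteq> j \<Longrightarrow> Y l = Z l"
  shows "Y = Z"
proof -
  have "restrict Y ({..<t} - {i, j}) = restrict Z ({..<t} - {i, j})"
    by (rule restrict_ext) (use eq in auto)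
  with bij_betw_imp_inj_on[OF bij_betw_restrict_sol[OF ij]] show ?thesis
    using Y by (rule inj_onD)
qed

text \<open>Were all t coordinates independent, a product over S would average
  \<open>(m / K) ^ card S\<close>. This is exact up to size t - 2, so only subsets of size t - 1 and
  t need a correction. The mean of \<open>g\<close> is left arbitrary because the even case uses a
  multiple of an uncentred indicator.\<close>

lemma sum_sol_prod_add:
  fixes c :: "'c::field_char_0" and n :: nat and g :: "'a vec \<Rightarrow> 'c"
  assumes t: "t \<ge> 2"
  defines "K \<equiv> of_nat (CARD('a) ^ n) :: 'c"
  defines "m \<equiv> \<Sum>x\<in>carrier_vec n. g x"
  shows "(\<Sum>Y\<in>sol n. \<Prod>i<t. c + g (Y i)) =
    K ^ (t - 2) * (c + m / K) ^ t
    + c * (\<Sum>i<t. (\<Sum>Y\<in>sol n. \<Prod>l\<in>{..<t} - {i}. g (Y l)) - K ^ (t - 2) * (m / K) ^ (t - 1))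
    + ((\<Sum>Y\<in>sol n. \<Prod>l<t. g (Y l)) - K ^ (t - 2) * (m / K) ^ t)"
proof -
  let ?P = "Pow {..<t}"
  define M where "M S = (\<Sum>Y\<in>sol n. \<Prod>l\<in>S. g (Y l))" for S
  \<comment> \<open>The defect of independence on S, with its weight in the expansion.\<close>
  define D where "D S = c ^ (t - card S) * (M S - K ^ (t - 2) * (m / K) ^ card S)" for S :: "nat set"
  have K: "K \<noteq> 0" by (simp add: K_def)
  have card: "card ({..<t} - S) = t - card S" if "S \<in> ?P" for S
    using that by (simp add: card_Diff_subset finite_subset)
  have expand: "(\<Prod>i<t. c + h i) = (\<Sum>S\<in>?P. c ^ (t - card S) * prod h S)" for h :: "nat \<Rightarrow> 'c"
  proof -
    have "(\<Prod>i<t. c + h i) = (\<Prod>i<t. h i + c)" by (simp add: add.commute)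
    also have "\<dots> = (\<Sum>S\<in>?P. prod h S * (\<Prod>i\<in>{..<t} - S. c))" by (rule prod_add) simp
    also have "\<dots> = (\<Sum>S\<in>?P. c ^ (t - card S) * prod h S)"
      by (intro sum.cong refl) (simp only: prod_constant card mult.commute)
    finally show ?thesis .
  qed
  have "(\<Sum>Y\<in>sol n. \<Prod>i<t. c + g (Y i)) = (\<Sum>S\<in>?P. c ^ (t - card S) * M S)"
    unfolding expand M_def by (subst sum.swap) (simp only: sum_distrib_left)
  also have "\<dots> = (\<Sum>S\<in>?P. K ^ (t - 2) * (c ^ (t - card S) * (\<Prod>i\<in>S. m / K)) + D S)"
    by (intro sum.cong refl) (simp add: D_def algebra_simps)
  also have "\<dots> = K ^ (t - 2) * (c + m / K) ^ t + (\<Sum>S\<in>?P. D S)"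
    using expand[of "\<lambda>_. m / K"] by (simp add: sum.distrib sum_distrib_left)
  also have "(\<Sum>S\<in>?P. D S) = (\<Sum>S\<in>insert {..<t} ((\<lambda>i. {..<t} - {i}) ` {..<t}). D S)"
  proof (rule sum.mono_neutral_right)
    show "\<forall>S\<in>?P - insert {..<t} ((\<lambda>i. {..<t} - {i}) ` {..<t}). D S = 0"
    proof
      fix S assume S: "S \<in> ?P - insert {..<t} ((\<lambda>i. {..<t} - {i}) ` {..<t})"
      have le: "card S \<le> t - 2"
      proof (rule ccontr)
        assume "\<not> card S \<le> t - 2"
        then have "card ({..<t} - S) \<le> 1" using card[of S] S by auto
        then have "card ({..<t} - S) = 0 \<or> card ({..<t} - S) = 1" by linarith
        then consider "{..<t} - S = {}" | i where "{..<t} - S = {i}"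
          by (metis card_1_singletonE card_eq_0_iff finite_Diff finite_lessThan)
        then show False
        proof cases
          case 1 then show False using S by auto
        next
          case 2
          then have "S = {..<t} - {i}" "i < t" using S by auto
          then show False using S by auto
        qed
      qed
      have "M S = m ^ card S * K ^ (t - 2 - card S)"
        using sum_sol_prod_subset[where S = S and n = n and g = g] S le t
        by (simp add: M_def m_def K_def)
      also have "\<dots> = K ^ (t - 2) * (m / K) ^ card S"
      proof -
        have "K ^ (t - 2) = K ^ (t - 2 - card S) * K ^ card S"
          by (simp only: power_add[symmetric] le_add_diff_inverse2[OF le])
        then show ?thesis using K by (simp add: power_divide)
      qed
      finally have "M S = K ^ (t - 2) * (m / K) ^ card S" .
      then show "D S = 0" by (simp add: D_def)
    qed
  qed auto
  also have "\<dots> = D {..<t} + (\<Sum>i<t. D ({..<t} - {i}))"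
  proof -
    have "inj_on (\<lambda>i. {..<t} - {i}) {..<t}" by (rule inj_onI) blast
    then have "(\<Sum>S\<in>(\<lambda>i. {..<t} - {i}) ` {..<t}. D S) = (\<Sum>i<t. D ({..<t} - {i}))"
      by (simp add: sum.reindex)
    moreover have "{..<t} \<notin> (\<lambda>i. {..<t} - {i}) ` {..<t}" by blast
    ultimately show ?thesis by simp
  qed
  also have "D {..<t} = M {..<t} - K ^ (t - 2) * (m / K) ^ t" by (simp add: D_def)
  also have "(\<Sum>i<t. D ({..<t} - {i})) = (\<Sum>i<t. c * (M ({..<t} - {i}) - K ^ (t - 2) * (m / K) ^ (t - 1)))"
    using t by (intro sum.cong refl) (simp add: D_def)
  finally show ?thesis by (simp add: M_def sum_distrib_left add_ac)
qed

end

section \<open>Linear systems as solution sets\<close>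

lemma minor_of_linearly_generic:
  fixes M :: "'a::field mat"
  assumes M: "M \<in> carrier_mat 2 t" and generic: "linearly_generic M" and ij: "i < t" "j < t" "i \<noteq> j"
  shows "M $$ (0, i) * M $$ (1, j) - M $$ (0, j) * M $$ (1, i) \<noteq> 0"
proof -
  have det: "det (mat_of_cols 2 [col M k, col M l]) =
      M $$ (0, k) * M $$ (1, l) - M $$ (0, l) * M $$ (1, k)" if "k < t" "l < t" for k l
    using laplace_expansion_row[of "mat_of_cols 2 [col M k, col M l]" 2 0] M that
    by (simp add: cofactor_def numeral_2_eq_2 det_single mat_delete_def mat_of_cols_def)
  show ?thesis
    using generic M ij det[of i j] det[of j i] unfolding linearly_generic_def
    by (cases "i < j") (auto simp: algebra_simps)
qed

lemma mem_mat_kernel_2_iff: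
  assumes "M \<in> carrier_mat 2 t" "z \<in> carrier_vec t"
  shows "z \<in> mat_kernel M \<longleftrightarrow>
    (\<Sum>i<t. M $$ (0, i) * z $ i) = 0 \<and> (\<Sum>i<t. M $$ (1, i) * z $ i) = 0"
proof -
  have "(M *\<^sub>v z) $ r = (\<Sum>i<t. M $$ (r, i) * z $ i)" if "r < 2" for r
    using assms that by (simp add: scalar_prod_def lessThan_atLeast0)
  moreover have "z \<in> mat_kernel M \<longleftrightarrow> (\<forall>r<2. (M *\<^sub>v z) $ r = 0)"
  proof
    assume "z \<in> mat_kernel M"
    then have "M *\<^sub>v z = 0\<^sub>v 2" using assms by (auto simp: mat_kernel_def)
    then show "\<forall>r<2. (M *\<^sub>v z) $ r = 0" by simp
  next
    assume "\<forall>r<2. (M *\<^sub>v z) $ r = 0"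
    then have "M *\<^sub>v z = 0\<^sub>v 2" using assms(1) by (intro eq_vecI) (auto simp del: index_mult_mat_vec)
    then show "z \<in> mat_kernel M" using assms by (auto simp: mat_kernel_def)
  qed
  ultimately show ?thesis
    by (auto simp: numeral_2_eq_2 less_Suc_eq)
qed

lemma form_action_index:
  assumes "Psi \<in> carrier_mat t D" "i < t" "k < n"
  shows "form_action Psi n i x $ k = (Psi *\<^sub>v vec D (\<lambda>j. x j $ k)) $ i"
  using assms by (simp add: form_action_def scalar_prod_def lessThan_atLeast0)

context
  fixes Psi M :: "'p::prime_card mod_ring mat" and D t :: nat
  assumes system: "linear_form_system D t Psi"
    and M: "M \<in> carrier_mat 2 t"
    and image: "Im_system Psi = mat_kernel M"
    and generic: "linearly_generic M"
begin

lemma generic_equation_pair_rows: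
  "generic_equation_pair (\<lambda>i. M $$ (0, i)) (\<lambda>i. M $$ (1, i)) t"
  by unfold_locales (rule minor_of_linearly_generic[OF M generic])

interpretation generic_equation_pair "\<lambda>i. M $$ (0, i)" "\<lambda>i. M $$ (1, i)" t
  by (rule generic_equation_pair_rows)

text \<open>The forms act on each of the n coordinates separately: the k-th entries of x form a
  vector of length D, and \<open>Psi\<close> maps it to the k-th entries of Y. Injectivity of
  \<open>Psi\<close> and the description of its image then apply for each k.\<close>

lemma bij_betw_forms_sol:
  "bij_betw (\<lambda>x. \<lambda>i\<in>{..<t}. form_action Psi n i x) ({..<D} \<rightarrow>\<^sub>E carrier_vec n) (sol n)"
proof -
  have Psi: "Psi \<in> carrier_mat t D" and inj: "inj_on ((*\<^sub>v) Psi) (carrier_vec D)"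
    using system by (auto simp: linear_form_system_def)
  have Im: "Im_system Psi = (*\<^sub>v) Psi ` carrier_vec D"
    using Psi by (auto simp: Im_system_def)
  let ?F = "\<lambda>x. \<lambda>i\<in>{..<t}. form_action Psi n i x"
  have F_carrier: "?F x \<in> {..<t} \<rightarrow>\<^sub>E carrier_vec n" for x
    by (auto simp: form_action_def)
  have col: "Psi *\<^sub>v vec D (\<lambda>j. x j $ k) = vec t (\<lambda>i. ?F x i $ k)" if "k < n" for x k
    using Psi that by (intro eq_vecI) (auto simp: form_action_index[OF Psi])
  have sol_iff: "Y \<in> sol n \<longleftrightarrow> (\<forall>k<n. vec t (\<lambda>i. Y i $ k) \<in> (*\<^sub>v) Psi ` carrier_vec D)"
    if "Y \<in> {..<t} \<rightarrow>\<^sub>E carrier_vec n" for Y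
    unfolding Im[symmetric] image using that mem_mat_kernel_2_iff[OF M, OF vec_carrier]
    by (simp add: sol_def del: One_nat_def)
  show ?thesis
  proof (rule bij_betwI')
    fix x y :: "nat \<Rightarrow> 'p mod_ring vec"
    assume x: "x \<in> {..<D} \<rightarrow>\<^sub>E carrier_vec n" and y: "y \<in> {..<D} \<rightarrow>\<^sub>E carrier_vec n"
    show "?F x = ?F y \<longleftrightarrow> x = y"
    proof
      assume eq: "?F x = ?F y"
      have vec_eq: "vec D (\<lambda>j. x j $ k) = vec D (\<lambda>j. y j $ k)" if "k < n" for k
        using inj_onD[OF inj] col[OF that, of x] col[OF that, of y] eq by (metis vec_carrier)
      have "x j $ k = y j $ k" if "j < D" "k < n" for j k
        using arg_cong[OF vec_eq[OF that(2)], of "\<lambda>v. v $ j"] that by simp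
      then have "x j = y j" if "j < D" for j
        using PiE_mem[OF x, of j] PiE_mem[OF y, of j] that by (intro eq_vecI) auto
      then show "x = y" using PiE_ext[OF x y] by auto
    qed simp
  next
    fix x :: "nat \<Rightarrow> 'p mod_ring vec" assume "x \<in> {..<D} \<rightarrow>\<^sub>E carrier_vec n"
    have "vec t (\<lambda>i. ?F x i $ k) \<in> (*\<^sub>v) Psi ` carrier_vec D" if "k < n" for k
      unfolding col[OF that, symmetric] by (rule imageI) simp
    then show "?F x \<in> sol n" using sol_iff[OF F_carrier] by blast
  next
    fix Y assume Y: "Y \<in> sol n"
    then have E: "Y \<in> {..<t} \<rightarrow>\<^sub>E carrier_vec n"
      by (simp add: sol_def del: One_nat_def)
    then obtain z where z: "\<And>k. k < n \<Longrightarrow> z k \<in> carrier_vec D \<and> vec t (\<lambda>i. Y i $ k) = Psi *\<^sub>v z k"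
      using sol_iff[OF E] Y unfolding image_iff by metis
    define x where "x = (\<lambda>j\<in>{..<D}. vec n (\<lambda>k. z k $ j))"
    have x: "x \<in> {..<D} \<rightarrow>\<^sub>E carrier_vec n" by (auto simp: x_def)
    have "vec D (\<lambda>j. x j $ k) = z k" if "k < n" for k
      using z[OF that] that by (intro eq_vecI) (auto simp: x_def)
    then have "vec t (\<lambda>i. ?F x i $ k) = vec t (\<lambda>i. Y i $ k)" if "k < n" for k
      using col[OF that, of x] z[OF that] that by simp
    then have "?F x i $ k = Y i $ k" if "i < t" "k < n" for i k
      using that by (metis index_vec)
    then have "?F x i = Y i" if "i < t" for i
      using PiE_mem[OF F_carrier, of i x] PiE_mem[OF E, of i] that by (intro eq_vecI) auto
    then have "Y = ?F x" using PiE_ext[OF E F_carrier] by auto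
    then show "\<exists>x\<in>{..<D} \<rightarrow>\<^sub>E carrier_vec n. Y = ?F x" using x by blast
  qed
qed

text \<open>The normalising factor is the number of solutions, so T depends only on the image and
  can be estimated from the two equations.\<close>

lemma T_system_eq_average_sol:
  "T_system Psi n F = (\<Sum>Y\<in>sol n. \<Prod>i<t. F (Y i)) / of_nat (card (sol n))"
proof -
  have Psi: "dim_row Psi = t" "dim_col Psi = D"
    using system by (auto simp: linear_form_system_def)
  have "(\<Sum>Y\<in>sol n. \<Prod>i<t. F (Y i)) =
      (\<Sum>x\<in>{..<D} \<rightarrow>\<^sub>E carrier_vec n. \<Prod>i<t. F ((\<lambda>i\<in>{..<t}. form_action Psi n i x) i))"
    by (rule sum.reindex_bij_betw[OF bij_betw_forms_sol, symmetric])
  also have "\<dots> = (\<Sum>x\<in>{..<D} \<rightarrow>\<^sub>E carrier_vec n. \<Prod>i<t. F (form_action Psi n i x))"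
    by (intro sum.cong prod.cong refl) simp
  moreover have "card (sol n) = CARD('p) ^ (n * D)"
    using bij_betw_same_card[OF bij_betw_forms_sol, of n]
    by (simp add: card_PiE card_carrier_vec power_mult)
  ultimately show ?thesis by (simp add: T_system_def Psi)
qed

text \<open>At \<alpha> = 1/2 the admissible range is symmetric, so the sign of \<open>f\<close> is
  at one's disposal. Both \<open>n\<close> and \<open>f\<close> may depend on \<epsilon>.\<close>

lemma not_locally_SidorenkoI:
  assumes "\<And>\<epsilon>::real. \<epsilon> > 0 \<Longrightarrow> \<exists>n\<ge>1. \<exists>f. (\<forall>x\<in>carrier_vec n. \<bar>f x\<bar> \<le> 1/2) \<and>
      (\<Sum>x\<in>carrier_vec n. f x) = 0 \<and>
      (\<Sum>Y\<in>sol n. \<Prod>i<t. 1/2 + \<epsilon> * f (Y i)) < (1/2) ^ t * card (sol n)"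
  shows "\<not> locally_Sidorenko Psi"
proof
  assume "locally_Sidorenko Psi"
  then have "0 \<le> (1/2::real) \<and> (1/2::real) \<le> 1 \<longrightarrow> (\<exists>\<epsilon>>0. \<forall>n\<ge>1. \<forall>f \<in> carrier_vec n \<rightarrow> {-(1/2)..1 - (1/2::real)}.
      expectation_vec n f = 0 \<longrightarrow> T_system Psi n (\<lambda>x. 1/2 + \<epsilon> * f x) \<ge> (1/2) ^ dim_row Psi)"
    unfolding locally_Sidorenko_def by blast
  then obtain \<epsilon> :: real where eps: "\<epsilon> > 0"
    "\<And>n f. n \<ge> 1 \<Longrightarrow> f \<in> carrier_vec n \<rightarrow> {-(1/2)..1 - (1/2::real)} \<Longrightarrow>
      expectation_vec n f = 0 \<Longrightarrow> T_system Psi n (\<lambda>x. 1/2 + \<epsilon> * f x) \<ge> (1/2) ^ dim_row Psi"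
    by auto
  obtain n f where n: "n \<ge> 1" and f: "\<And>x. x \<in> carrier_vec n \<Longrightarrow> \<bar>f x\<bar> \<le> 1/2"
      "(\<Sum>x\<in>carrier_vec n. f x) = 0"
      "(\<Sum>Y\<in>sol n. \<Prod>i<t. 1/2 + \<epsilon> * f (Y i)) < (1/2) ^ t * card (sol n)"
    using assms[OF eps(1)] by blast
  have Psi: "dim_row Psi = t" using system by (auto simp: linear_form_system_def)
  have "card (sol n) = (CARD('p) ^ n) ^ D"
    using bij_betw_same_card[OF bij_betw_forms_sol, of n] by (simp add: card_PiE card_carrier_vec)
  then have card: "real (card (sol n)) > 0" by simp
  have "-(1/2) \<le> f x \<and> f x \<le> 1/2" if "x \<in> carrier_vec n" for x
    using f(1)[OF that] by linarith
  then have "f \<in> carrier_vec n \<rightarrow> {-(1/2)..1 - (1/2::real)}" by auto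
  from eps(2)[OF n this] have "(1/2) ^ t \<le> T_system Psi n (\<lambda>x. 1/2 + \<epsilon> * f x)"
    using f(2) by (simp add: expectation_vec_def Psi)
  then show False
    using f(3) card by (simp add: T_system_eq_average_sol pos_le_divide_eq)
qed

end

section \<open>Even systems and systems of three forms\<close>

lemma (in generic_equation_pair) zero_mem_sol: "(\<lambda>i\<in>{..<t}. 0\<^sub>v n) \<in> sol n"
  by (simp add: sol_def)

text \<open>A solution vanishing at t - 1 indices agrees with the zero solution on t - 2 free
  coordinates, hence is zero. Only one summand survives.\<close>

lemma (in generic_equation_pair) sum_sol_prod_at_zero:
  fixes c :: "'c::comm_semiring_1"
  assumes S: "{..<t} - {i} \<subseteq> S" "S \<subseteq> {..<t}" and t: "t \<ge> 2" and i: "i < t"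
  shows "(\<Sum>Y\<in>sol n. \<Prod>l\<in>S. c * of_bool (Y l = 0\<^sub>v n)) = c ^ card S"
proof -
  let ?Z = "\<lambda>i\<in>{..<t}. 0\<^sub>v n :: 'a vec"
  obtain j where j: "j < t" "j \<noteq> i"
    using t by (metis Suc_le_eq dual_order.strict_trans1 less_2_cases_iff nat_neq_iff
        numeral_2_eq_2 zero_less_Suc)
  have fin: "finite S" using S(2) finite_subset by blast
  have vanish: "(\<Prod>l\<in>S. c * of_bool (Y l = 0\<^sub>v n)) = 0" if "Y \<in> sol n" "Y \<noteq> ?Z" for Y
  proof -
    have "\<exists>l\<in>S. Y l \<noteq> 0\<^sub>v n"
    proof (rule ccontr)
      assume "\<not> (\<exists>l\<in>S. Y l \<noteq> 0\<^sub>v n)"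
      then have "Y = ?Z"
        using S j by (intro sol_eqI[OF that(1) zero_mem_sol i j(1)]) auto
      then show False using that by simp
    qed
    then show ?thesis using fin by (intro prod_zero) auto
  qed
  have "(\<Sum>Y\<in>sol n. \<Prod>l\<in>S. c * of_bool (Y l = 0\<^sub>v n)) =
      (\<Sum>Y\<in>{?Z}. \<Prod>l\<in>S. c * of_bool (Y l = 0\<^sub>v n))"
    by (intro sum.mono_neutral_right) (auto simp: zero_mem_sol vanish)
  also have "\<dots> = (\<Prod>l\<in>S. c)"
    using S(2) by (simp add: subset_iff cong: prod.cong)
  finally show ?thesis by simp
qed

text \<open>Dimension one suffices. The t terms with t - 1 factors are negative of order
  \<open>b ^ (t - 1)\<close>, the full term is positive of order \<open>b ^ t\<close>; together they
  are minus the product of \<open>b ^ (t - 1)\<close>, \<open>1 - 1 / K\<close> and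
  \<open>t * A - b * (1 + 1 / K)\<close>.\<close>

lemma (in generic_equation_pair) even_deviation:
  fixes \<epsilon> :: real
  assumes t: "t \<ge> 2" "even t" and eps: "\<epsilon> > 0"
  shows "\<exists>n\<ge>1. \<exists>f. (\<forall>x\<in>carrier_vec n. \<bar>f x\<bar> \<le> 1/2) \<and> (\<Sum>x\<in>carrier_vec n. f x) = 0 \<and>
      (\<Sum>Y\<in>sol n. \<Prod>i<t. 1/2 + \<epsilon> * f (Y i)) < (1/2) ^ t * card (sol n)"
proof -
  define K where "K = real CARD('a)"
  have "card {0, 1 :: 'a} \<le> CARD('a)" by (rule card_mono) auto
  then have K: "K \<ge> 2" by (simp add: K_def)
  \<comment> \<open>The bound 1/2 makes \<open>f\<close> admissible. The bound
    \<open>1 / (2 * \<epsilon>)\<close> gives \<open>b \<le> 1/2\<close>, so that for large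
    \<epsilon> the positive full term does not take over.\<close>
  define d where "d = min (1/2) (1 / (2 * \<epsilon>))"
  define f where "f x = d * (1 / K - of_bool (x = 0\<^sub>v 1))" for x :: "'a vec"
  define b where "b = \<epsilon> * d"
  have d: "0 < d" "d \<le> 1/2" using eps by (auto simp: d_def)
  have b: "0 < b" "b \<le> 1/2"
  proof -
    show "0 < b" using eps d by (simp add: b_def)
    have "b \<le> \<epsilon> * (1 / (2 * \<epsilon>))" unfolding b_def d_def using eps by (intro mult_left_mono) auto
    then show "b \<le> 1/2" using eps by simp
  qed
  have f_bound: "\<bar>f x\<bar> \<le> 1/2" for x
  proof -
    have "\<bar>1 / K - of_bool (x = 0\<^sub>v 1)\<bar> \<le> 1" using K by (auto simp: of_bool_def abs_le_iff field_simps)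
    then have "\<bar>f x\<bar> \<le> d * 1" unfolding f_def abs_mult using d by (intro mult_mono) auto
    then show ?thesis using d by simp
  qed
  have delta: "(\<Sum>x\<in>carrier_vec 1. c * of_bool (x = (0\<^sub>v 1 :: 'a vec))) = c" for c :: real
    by (simp add: of_bool_def if_distrib cong: if_cong)
  have f_sum: "(\<Sum>x\<in>carrier_vec 1. f x) = 0"
    using delta[of d] K
    by (simp add: f_def right_diff_distrib sum_subtractf card_carrier_vec K_def)
  \<comment> \<open>The constant part of \<open>\<epsilon> * f\<close> moves into \<open>A\<close>,
    which leaves a function supported at the origin; the total mean \<open>A - b / K\<close> is
    still 1/2.\<close>
  define A where "A = 1/2 + b / K"
  define g where "g x = - b * of_bool (x = 0\<^sub>v 1)" for x :: "'a vec"
  obtain t' where t': "t = Suc (Suc t')" using t(1) by (metis add_2_eq_Suc le_Suc_ex)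
  have "(\<Sum>Y\<in>sol 1. \<Prod>i<t. 1/2 + \<epsilon> * f (Y i)) = (\<Sum>Y\<in>sol 1. \<Prod>i<t. A + g (Y i))"
    by (simp add: f_def A_def g_def b_def algebra_simps)
  also have "\<dots> = K ^ (t - 2) * (A + - b / K) ^ t
      + A * (\<Sum>i<t. (- b) ^ (t - 1) - K ^ (t - 2) * (- b / K) ^ (t - 1))
      + ((- b) ^ t - K ^ (t - 2) * (- b / K) ^ t)"
  proof -
    have "(\<Sum>Y\<in>sol 1. \<Prod>l\<in>{..<t} - {i}. g (Y l)) = (- b) ^ (t - 1)" if "i < t" for i
      unfolding g_def using that t(1) by (subst sum_sol_prod_at_zero[of i]) auto
    moreover have "(\<Sum>Y\<in>sol 1. \<Prod>l<t. g (Y l)) = (- b) ^ t"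
      unfolding g_def using t(1) by (subst sum_sol_prod_at_zero[of 0]) auto
    moreover have "(\<Sum>x\<in>carrier_vec 1. g x) = - b"
      unfolding g_def by (rule delta)
    ultimately show ?thesis
      using sum_sol_prod_add[OF t(1), of A g 1] by (simp add: K_def)
  qed
  also have "\<dots> = K ^ (t - 2) * (1/2) ^ t - b ^ (t - 1) * (1 - 1 / K) * (t * A - b * (1 + 1 / K))"
  proof -
    have 1: "K ^ (t - 2) * (- b / K) ^ (t - 1) = - (b ^ (t - 1)) / K"
      using K t(2) by (simp add: t' power_divide)
    have 2: "K ^ (t - 2) * (- b / K) ^ t = b ^ (t - 1) * b / K ^ 2"
      using K t(2) by (simp add: t' power_divide power2_eq_square)
    have 3: "(- b) ^ (t - 1) = - (b ^ (t - 1))" "(- b) ^ t = b ^ (t - 1) * b"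
      using t(2) by (simp_all add: t')
    show ?thesis
      unfolding 1 2 3 using K by (simp add: A_def field_simps power2_eq_square)
  qed
  also have "\<dots> < K ^ (t - 2) * (1/2) ^ t"
  proof -
    have "b * (1 + 1 / K) \<le> (1/2) * (3/2)" using K b by (intro mult_mono) (auto simp: field_simps)
    also have "\<dots> < 2 * (1/2)" by simp
    also have "\<dots> \<le> real t * A"
      using t(1) K b by (intro mult_mono) (auto simp: A_def)
    finally have "t * A - b * (1 + 1 / K) > 0" by simp
    moreover have "1 - 1 / K > 0" using K by simp
    ultimately have "b ^ (t - 1) * (1 - 1 / K) * (t * A - b * (1 + 1 / K)) > 0" using b by simp
    then show ?thesis by simp
  qed
  also have "\<dots> = (1/2) ^ t * card (sol 1)" using card_sol[OF t(1), of 1] by (simp add: K_def)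
  finally show ?thesis using f_bound f_sum by (intro exI[of _ 1]) auto
qed

section \<open>Three forms in one variable\<close>

lemma sum_scale_field:
  fixes f :: "'a::{finite,field} \<Rightarrow> 'b::comm_monoid_add"
  assumes "u \<noteq> 0"
  shows "(\<Sum>x\<in>UNIV. f (u * x)) = (\<Sum>x\<in>UNIV. f x)"
  using assms
  by (intro sum.reindex_bij_witness[where i = "\<lambda>x. x / u" and j = "\<lambda>x. u * x"]) auto

text \<open>Rescaling by u turns the forms into x, x, r x. With f = 1 at 1 and -1 at r, only x = 1,
  r, 1/r contribute to the deviation. If r = 1/r, the total is of second order and negative.
  Otherwise the first and second orders cancel and \<open>- \<eta> ^ 3\<close> remains, which is
  negative for every \<eta>.\<close>

lemma double_form_deviation:
  fixes u w :: "'a::{finite,field}" and \<alpha> \<eta> :: real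
  assumes u: "u \<noteq> 0" "w \<noteq> 0" "u \<noteq> w" and pos: "\<alpha> > 0" "\<eta> > 0"
  shows "\<exists>f. (\<forall>x. \<bar>f x\<bar> \<le> 1) \<and> (\<Sum>x\<in>UNIV. f x) = 0 \<and>
    (\<Sum>x\<in>UNIV. (\<alpha> + \<eta> * f (u * x)) * (\<alpha> + \<eta> * f (u * x)) * (\<alpha> + \<eta> * f (w * x)))
      < \<alpha> ^ 3 * CARD('a)"
proof -
  define r where "r = w / u"
  have r: "r \<noteq> 0" "r \<noteq> 1" using u by (auto simp: r_def)
  define f where "f x = of_bool (x = 1) - (of_bool (x = r) :: real)" for x
  define G where "G x = (\<alpha> + \<eta> * f x) * (\<alpha> + \<eta> * f x) * (\<alpha> + \<eta> * f (r * x)) - \<alpha> ^ 3" for x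
  have "(\<Sum>x\<in>UNIV. (\<alpha> + \<eta> * f (u * x)) * (\<alpha> + \<eta> * f (u * x)) * (\<alpha> + \<eta> * f (w * x)) - \<alpha> ^ 3)
      = (\<Sum>x\<in>UNIV. G x)"
    using sum_scale_field[OF u(1), of G] u by (simp add: G_def r_def)
  also have "\<dots> = (\<Sum>x\<in>{1, r, 1 / r}. G x)"
    using r by (intro sum.mono_neutral_right)
      (auto simp: G_def f_def of_bool_def field_simps power3_eq_cube)
  also have "\<dots> < 0"
  proof (cases "r = 1 / r")
    case True
    then have rr: "r * r = 1" using r by (simp add: field_simps)
    then have "(\<Sum>x\<in>{1, r, 1 / r}. G x) = G 1 + G r" using True[symmetric] r by simp
    also have "\<dots> = - (2 * \<alpha> * \<eta> * \<eta>)"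
      using r rr by (simp add: G_def f_def algebra_simps power3_eq_cube)
    finally show ?thesis using pos by simp
  next
    case False
    then have rr: "r * r \<noteq> 1" "1 / r \<noteq> 1" using r by (auto simp: field_simps)
    have "(\<Sum>x\<in>{1, r, 1 / r}. G x) = G 1 + G r + G (1 / r)" using False rr r by simp
    also have "\<dots> = - (\<eta> * \<eta> * \<eta>)"
      using r rr False by (simp add: G_def f_def algebra_simps power3_eq_cube)
    finally show ?thesis using pos by simp
  qed
  finally have "(\<Sum>x\<in>UNIV. (\<alpha> + \<eta> * f (u * x)) * (\<alpha> + \<eta> * f (u * x)) * (\<alpha> + \<eta> * f (w * x)))
      < \<alpha> ^ 3 * CARD('a)"
    by (simp add: sum_subtractf mult.commute)
  moreover have "(\<Sum>x\<in>UNIV. f x) = 0"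
    by (simp add: f_def sum_subtractf of_bool_def)
  moreover have "\<bar>f x\<bar> \<le> 1" for x by (simp add: f_def of_bool_def)
  ultimately show ?thesis by blast
qed

text \<open>\<open>f\<close> takes opposite signs on its two-point support. For x \<noteq> 0 the
  three arguments are distinct, so the cubic term vanishes and each quadratic product is at most 0.
  The linear terms sum to zero, and x = 1 makes the quadratic sum strictly negative.\<close>

lemma distinct_forms_deviation:
  fixes u v w :: "'a::{finite,field}" and \<alpha> \<eta> :: real
  assumes nz: "u \<noteq> 0" "v \<noteq> 0" "w \<noteq> 0" and dist: "u \<noteq> v" "v \<noteq> w" "u \<noteq> w"
    and pos: "\<alpha> > 0" "\<eta> > 0"
  shows "\<exists>f. (\<forall>x. \<bar>f x\<bar> \<le> 1) \<and> (\<Sum>x\<in>UNIV. f x) = 0 \<and>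
    (\<Sum>x\<in>UNIV. (\<alpha> + \<eta> * f (u * x)) * (\<alpha> + \<eta> * f (v * x)) * (\<alpha> + \<eta> * f (w * x)))
      < \<alpha> ^ 3 * CARD('a)"
proof -
  define f where "f x = of_bool (x = u) - (of_bool (x = v) :: real)" for x
  define q where "q x = f (u * x) * f (v * x) + f (v * x) * f (w * x) + f (u * x) * f (w * x)" for x
  have f_sum: "(\<Sum>x\<in>UNIV. f x) = 0"
    by (simp add: f_def sum_subtractf of_bool_def)
  have two: "f y * f z \<le> 0" if "y \<noteq> z" for y z
    using that by (auto simp: f_def of_bool_def)
  have three: "f y * f z * f s = 0" if "y \<noteq> z" "z \<noteq> s" "y \<noteq> s" for y z s
    using that by (auto simp: f_def of_bool_def)
  have f0: "f 0 = 0" using nz by (simp add: f_def)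
  have q: "q x \<le> 0" for x
    using two[of "u * x" "v * x"] two[of "v * x" "w * x"] two[of "u * x" "w * x"] dist
    by (cases "x = 0") (auto simp: q_def f0 intro!: add_nonpos_nonpos)
  have "q 1 < 0" using dist by (simp add: q_def f_def)
  then have "(\<Sum>x\<in>UNIV. q x) < (\<Sum>x\<in>(UNIV :: 'a set). 0)"
    using q by (intro sum_strict_mono_ex1) auto
  then have q_sum: "\<alpha> * \<eta>\<^sup>2 * (\<Sum>x\<in>UNIV. q x) < 0"
    using pos by (simp add: mult_pos_neg)
  have "(\<alpha> + \<eta> * f (u * x)) * (\<alpha> + \<eta> * f (v * x)) * (\<alpha> + \<eta> * f (w * x)) =
      \<alpha> ^ 3 + \<alpha>\<^sup>2 * \<eta> * (f (u * x) + f (v * x) + f (w * x)) + \<alpha> * \<eta>\<^sup>2 * q x" for x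
  proof -
    have "f (u * x) * f (v * x) * f (w * x) = 0"
      using three[of "u * x" "v * x" "w * x"] dist f0 by (cases "x = 0") auto
    moreover have "(\<alpha> + \<eta> * f (u * x)) * (\<alpha> + \<eta> * f (v * x)) * (\<alpha> + \<eta> * f (w * x)) =
      \<alpha> ^ 3 + \<alpha>\<^sup>2 * \<eta> * (f (u * x) + f (v * x) + f (w * x)) + \<alpha> * \<eta>\<^sup>2 * q x
       + \<eta> ^ 3 * (f (u * x) * f (v * x) * f (w * x))"
      by (simp add: q_def algebra_simps power2_eq_square power3_eq_cube)
    ultimately show ?thesis by simp
  qed
  then have "(\<Sum>x\<in>UNIV. (\<alpha> + \<eta> * f (u * x)) * (\<alpha> + \<eta> * f (v * x)) * (\<alpha> + \<eta> * f (w * x))) =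
      \<alpha> ^ 3 * CARD('a) + \<alpha>\<^sup>2 * \<eta> * (\<Sum>x\<in>UNIV. f (u * x) + f (v * x) + f (w * x))
       + \<alpha> * \<eta>\<^sup>2 * (\<Sum>x\<in>UNIV. q x)"
    by (simp add: sum.distrib flip: sum_distrib_left)
  also have "(\<Sum>x\<in>UNIV. f (u * x) + f (v * x) + f (w * x)) = 0"
    using nz by (simp add: sum.distrib sum_scale_field f_sum)
  finally have "(\<Sum>x\<in>UNIV. (\<alpha> + \<eta> * f (u * x)) * (\<alpha> + \<eta> * f (v * x)) * (\<alpha> + \<eta> * f (w * x)))
      < \<alpha> ^ 3 * CARD('a)" using q_sum by simp
  moreover have "\<bar>f x\<bar> \<le> 1" for x by (simp add: f_def of_bool_def)
  ultimately show ?thesis using f_sum by blast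
qed

lemma three_forms_deviation:
  fixes u v w :: "'a::{finite,field}" and \<alpha> \<eta> :: real
  assumes nz: "u \<noteq> 0" "v \<noteq> 0" "w \<noteq> 0" and neq: "\<not> (u = v \<and> v = w)"
    and pos: "\<alpha> > 0" "\<eta> > 0"
  shows "\<exists>f. (\<forall>x. \<bar>f x\<bar> \<le> 1) \<and> (\<Sum>x\<in>UNIV. f x) = 0 \<and>
    (\<Sum>x\<in>UNIV. (\<alpha> + \<eta> * f (u * x)) * (\<alpha> + \<eta> * f (v * x)) * (\<alpha> + \<eta> * f (w * x)))
      < \<alpha> ^ 3 * CARD('a)"
proof -
  consider "u \<noteq> v" "v \<noteq> w" "u \<noteq> w" | "u = v" "u \<noteq> w" | "v = w" "v \<noteq> u" | "u = w" "u \<noteq> v"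
    using neq by blast
  then show ?thesis
  proof cases
    case 1 then show ?thesis using distinct_forms_deviation[OF nz] pos by blast
  next
    case 2 then show ?thesis using double_form_deviation[OF nz(1,3) _ pos] by simp
  next
    case 3 then show ?thesis using double_form_deviation[OF nz(2,1) _ pos] by (simp add: mult_ac)
  next
    case 4 then show ?thesis using double_form_deviation[OF nz(1,2) _ pos] by (simp add: mult_ac)
  qed
qed

text \<open>The solutions form the line spanned by the cross product \<open>c\<close> of the two
  rows, whose entries are minors and so nonzero. \<open>neq\<close> rules out three equal
  entries.\<close>

lemma (in generic_equation_pair) three_deviation:
  fixes \<epsilon> :: real
  assumes t: "t = 3" and eps: "\<epsilon> > 0"
    and neq: "\<exists>Y\<in>sol 1. \<exists>i<t. \<exists>j<t. Y i \<noteq> Y j"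
  shows "\<exists>n\<ge>1. \<exists>f. (\<forall>x\<in>carrier_vec n. \<bar>f x\<bar> \<le> 1/2) \<and> (\<Sum>x\<in>carrier_vec n. f x) = 0 \<and>
      (\<Sum>Y\<in>sol n. \<Prod>i<t. 1/2 + \<epsilon> * f (Y i)) < (1/2) ^ t * card (sol n)"
proof -
  define c :: "nat \<Rightarrow> 'a" where "c i = [a 1 * b 2 - a 2 * b 1, a 2 * b 0 - a 0 * b 2, a 0 * b 1 - a 1 * b 0] ! i" for i
  have c: "c 0 \<noteq> 0" "c 1 \<noteq> 0" "c 2 \<noteq> 0"
    using minor[of 1 2] minor[of 2 0] minor[of 0 1] t by (auto simp: c_def numeral_2_eq_2)
  have less3: "i < 3 \<longleftrightarrow> i = 0 \<or> i = 1 \<or> i = 2" for i :: nat by auto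
  have sum3: "(\<Sum>i<3. h i) = h 0 + h 1 + h 2" for h :: "nat \<Rightarrow> 'a"
    by (simp add: numeral_3_eq_3 numeral_2_eq_2)
  define y where "y w = (\<lambda>i\<in>{..<t}. vec 1 (\<lambda>_. c i * w))" for w
  have y_mem: "y w \<in> sol 1" for w
    unfolding sol_def unfolding y_def t by (auto simp: sum3 c_def algebra_simps)
  have "inj y"
  proof (rule injI)
    fix w w' assume "y w = y w'"
    then have "y w 0 $ 0 = y w' 0 $ 0" by simp
    then show "w = w'" using c by (simp add: y_def t)
  qed
  moreover have "range y = sol 1"
  proof (rule card_subset_eq)
    show "card (range y) = card (sol 1)"
      using card_image[OF \<open>inj y\<close>] card_sol[of 1] t by simp
  qed (use y_mem in auto)
  ultimately have y: "bij_betw y UNIV (sol 1)" by (simp add: bij_betw_def)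
  have "\<not> (c 0 = c 1 \<and> c 1 = c 2)"
  proof
    assume eq: "c 0 = c 1 \<and> c 1 = c 2"
    from neq obtain Y i j where Y: "Y \<in> sol 1" "i < t" "j < t" "Y i \<noteq> Y j" by blast
    then obtain w where "Y = y w" using y by (auto simp: bij_betw_def)
    then show False using Y eq t by (auto simp: y_def less3)
  qed
  then obtain f where f: "\<And>x. \<bar>f x\<bar> \<le> 1" "(\<Sum>x\<in>UNIV. f x) = 0"
    "(\<Sum>x\<in>UNIV. (1/2 + \<epsilon>/2 * f (c 0 * x)) * (1/2 + \<epsilon>/2 * f (c 1 * x)) * (1/2 + \<epsilon>/2 * f (c 2 * x)))
      < (1/2) ^ 3 * CARD('a)"
    using three_forms_deviation[OF c, of "1/2" "\<epsilon>/2"] eps by auto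
  define g where "g x = f (x $ 0) / 2" for x
  have "(\<Sum>Y\<in>sol 1. \<Prod>i<t. 1/2 + \<epsilon> * g (Y i)) = (\<Sum>w\<in>UNIV. \<Prod>i<t. 1/2 + \<epsilon> * g (y w i))"
    by (rule sum.reindex_bij_betw[OF y, symmetric])
  also have "\<dots> < (1/2) ^ t * card (sol 1)"
    using f(3) card_sol[of 1] t by (simp add: numeral_3_eq_3 numeral_2_eq_2 y_def g_def)
  finally have "(\<Sum>Y\<in>sol 1. \<Prod>i<t. 1/2 + \<epsilon> * g (Y i)) < (1/2) ^ t * card (sol 1)" .
  moreover have "(\<Sum>x\<in>carrier_vec 1. g x) = 0"
  proof -
    have "(\<Sum>x\<in>carrier_vec 1. g x) = (\<Sum>w\<in>UNIV. f w / 2)"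
      by (rule sum.reindex_bij_witness[where j = "\<lambda>x. x $ 0" and i = "\<lambda>w. vec 1 (\<lambda>_. w)"])
        (auto simp: g_def)
    then show ?thesis using f(2) by (simp flip: sum_divide_distrib)
  qed
  moreover have "\<bar>g x\<bar> \<le> 1/2" for x using f(1) by (simp add: g_def)
  ultimately show ?thesis by (intro exI[of _ 1]) auto
qed

section \<open>Isotropic weights\<close>

text \<open>These sums are divided differences: the one of h on \<open>A - {y}\<close> is the one of
  (x - x y) h on \<open>A\<close>, where the added summand at y has numerator zero.\<close>

lemma sum_div_prod_diff_remove:
  fixes x :: "'i \<Rightarrow> 'a::field"
  assumes A: "finite A" "inj_on x A" and y: "y \<in> A"
  shows "(\<Sum>i\<in>A - {y}. h i / (\<Prod>j\<in>A - {y} - {i}. x i - x j)) =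
    (\<Sum>i\<in>A. (x i - x y) * h i / (\<Prod>j\<in>A - {i}. x i - x j))"
proof -
  have "h i / (\<Prod>j\<in>A - {y} - {i}. x i - x j) =
      (x i - x y) * h i / (\<Prod>j\<in>A - {i}. x i - x j)" if "i \<in> A - {y}" for i
  proof -
    have "x i - x y \<noteq> 0" using that A y by (auto dest: inj_onD)
    moreover have "(\<Prod>j\<in>A - {i}. x i - x j) = (x i - x y) * (\<Prod>j\<in>A - {i} - {y}. x i - x j)"
      using that A y by (intro prod.remove) auto
    moreover have "A - {i} - {y} = A - {y} - {i}" by auto
    ultimately show ?thesis by simp
  qed
  then have "(\<Sum>i\<in>A - {y}. h i / (\<Prod>j\<in>A - {y} - {i}. x i - x j)) =
      (\<Sum>i\<in>A - {y}. (x i - x y) * h i / (\<Prod>j\<in>A - {i}. x i - x j))"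
    by (rule sum.cong[OF refl])
  also have "\<dots> = (\<Sum>i\<in>A. (x i - x y) * h i / (\<Prod>j\<in>A - {i}. x i - x j))"
    using A(1) y by (intro sum.mono_neutral_left) auto
  finally show ?thesis .
qed

text \<open>The divided difference of the constant 1 vanishes. Removing y or z gives the same value
  by induction, while the two values differ by \<open>x z - x y\<close> times the sum in
  question.\<close>

lemma sum_inverse_prod_diff:
  fixes x :: "'i \<Rightarrow> 'a::field"
  assumes "finite A" "inj_on x A" "card A \<ge> 2"
  shows "(\<Sum>i\<in>A. 1 / (\<Prod>j\<in>A - {i}. x i - x j)) = 0"
  using assms
proof (induction "card A" arbitrary: A rule: less_induct)
  case less
  define S where "S B = (\<Sum>i\<in>B. 1 / (\<Prod>j\<in>B - {i}. x i - x j))" for B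
  obtain T where T: "T \<subseteq> A" "card T = 2"
    using obtain_subset_with_card_n[OF less.prems(3)] by blast
  then obtain y z where yz: "y \<in> A" "z \<in> A" "y \<noteq> z" by (auto simp: card_2_iff)
  \<comment> \<open>For two points the remaining one gives an empty product and the value 1. This
    does not depend on \<open>w\<close>, so the induction needs no separate base case.\<close>
  have remove: "S (A - {w}) = (if card A = 2 then 1 else 0)" if "w \<in> A" for w
  proof (cases "card A = 2")
    case True
    then have "card (A - {w}) = 1" using that less.prems(1) by simp
    then obtain v where "A - {w} = {v}" by (rule card_1_singletonE)
    then show ?thesis using True by (simp add: S_def)
  next
    case False
    then show ?thesis
      using less.hyps[of "A - {w}"] less.prems that unfolding S_def
      by (simp add: inj_on_diff card_Diff_singleton_if card_gt_0_iff)
  qed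
  have "S (A - {y}) - S (A - {z}) =
      (\<Sum>i\<in>A. (x i - x y) * 1 / (\<Prod>j\<in>A - {i}. x i - x j)) -
      (\<Sum>i\<in>A. (x i - x z) * 1 / (\<Prod>j\<in>A - {i}. x i - x j))"
    using sum_div_prod_diff_remove[OF less.prems(1,2) yz(1), of "\<lambda>_. 1"]
      sum_div_prod_diff_remove[OF less.prems(1,2) yz(2), of "\<lambda>_. 1"] by (simp add: S_def)
  also have "\<dots> = (\<Sum>i\<in>A. (x z - x y) * (1 / (\<Prod>j\<in>A - {i}. x i - x j)))"
    unfolding sum_subtractf[symmetric]
    by (intro sum.cong refl) (simp add: diff_divide_distrib)
  also have "\<dots> = (x z - x y) * S A" by (simp add: S_def sum_distrib_left)
  finally have "(x z - x y) * S A = 0" using remove yz by simp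
  moreover have "x z \<noteq> x y" using yz less.prems(2) by (auto dest: inj_onD)
  ultimately show ?case by (simp add: S_def)
qed

text \<open>A divided difference on k points kills polynomials of degree at most k - 2, so four
  points suffice for degree 2. Writing x as (x - x y) + x y lowers the degree at the cost of one
  point.\<close>

lemma ex_vanishing_moment_weights:
  fixes x :: "'i \<Rightarrow> 'a::field"
  assumes A: "finite A" "inj_on x A" "card A \<ge> 4"
  obtains \<nu> where "\<And>i. i \<in> A \<Longrightarrow> \<nu> i \<noteq> 0" "(\<Sum>i\<in>A. \<nu> i) = 0" "(\<Sum>i\<in>A. \<nu> i * x i) = 0"
    "(\<Sum>i\<in>A. \<nu> i * (x i)\<^sup>2) = 0"
proof -
  define \<nu> where "\<nu> B i = 1 / (\<Prod>j\<in>B - {i}. x i - x j)" for B i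
  have zero: "(\<Sum>i\<in>B. \<nu> B i) = 0" if "finite B" "inj_on x B" "card B \<ge> 2" for B
    unfolding \<nu>_def by (rule sum_inverse_prod_diff[OF that])
  have shift: "(\<Sum>i\<in>B. \<nu> B i * (x i * h i)) =
      (\<Sum>i\<in>B - {y}. \<nu> (B - {y}) i * h i) + x y * (\<Sum>i\<in>B. \<nu> B i * h i)"
    if "finite B" "inj_on x B" "y \<in> B" for B y h
    using sum_div_prod_diff_remove[OF that, of h]
    by (simp add: \<nu>_def sum_distrib_left algebra_simps diff_divide_distrib sum_subtractf)
  have sub: "finite (B - {y})" "inj_on x (B - {y})" "card (B - {y}) = card B - 1"
    if "finite B" "inj_on x B" "y \<in> B" for B y
    using that by (auto intro: inj_on_diff)
  have one: "(\<Sum>i\<in>B. \<nu> B i * x i) = 0" if B: "finite B" "inj_on x B" "card B \<ge> 3" for B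
  proof -
    obtain y where y: "y \<in> B" using B(3) by (cases "B = {}") auto
    show ?thesis
      using shift[OF B(1,2) y, of "\<lambda>_. 1"] zero[of B] zero[of "B - {y}"] sub[OF B(1,2) y] B by simp
  qed
  obtain y where y: "y \<in> A" using A(3) by (cases "A = {}") auto
  have "(\<Sum>i\<in>A. \<nu> A i * (x i)\<^sup>2) = 0"
    using shift[OF A(1,2) y, of x] one[of A] one[of "A - {y}"] sub[OF A(1,2) y] A
    by (simp add: power2_eq_square)
  moreover have "\<nu> A i \<noteq> 0" if "i \<in> A" for i
    using A that by (auto simp: \<nu>_def dest: inj_onD)
  ultimately show ?thesis using that[of "\<nu> A"] zero[of A] one[of A] A by simp
qed

section \<open>Columns as points of the projective line\<close>

context generic_equation_pair
begin

text \<open>\<open>None\<close> is the point at infinity.\<close>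

definition slope :: "nat \<Rightarrow> 'a option" where
  "slope i = (if a i = 0 then None else Some (b i / a i))"

lemma inj_on_slope: "inj_on slope {..<t}"
proof (rule inj_onI, rule ccontr)
  fix i j assume "i \<in> {..<t}" "j \<in> {..<t}" and eq: "slope i = slope j" and "i \<noteq> j"
  then have "a i * b j - a j * b i \<noteq> 0" using minor by simp
  then show False using eq by (auto simp: slope_def field_simps split: if_splits)
qed

lemma card_option_field: "card (UNIV :: 'a option set) = CARD('a) + 1"
  by (simp add: UNIV_option_conv card_image)

lemma number_of_forms_le: "t \<le> CARD('a) + 1"
  using card_inj_on_le[OF inj_on_slope subset_UNIV] by (simp add: card_option_field)

text \<open>There is one slope more than there are field elements, so t columns miss some slope, and
  the linear form vanishing at that slope is nonzero on every column. Dividing by it gives distinct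
  affine coordinates, in which the quadratic moments become combinations of the moments of order 0,
  1 and 2.\<close>

lemma ex_isotropic_weights:
  assumes t: "t \<ge> 4" "t \<le> CARD('a)"
  obtains \<mu> where "\<And>i. i < t \<Longrightarrow> \<mu> i \<noteq> 0" "(\<Sum>i<t. \<mu> i * (a i)\<^sup>2) = 0"
    "(\<Sum>i<t. \<mu> i * (a i * b i)) = 0" "(\<Sum>i<t. \<mu> i * (b i)\<^sup>2) = 0"
proof -
  have "slope ` {..<t} \<noteq> UNIV"
    using card_image[OF inj_on_slope] t(2) card_option_field by auto
  then obtain s where "s \<notin> slope ` {..<t}" by blast
  then have s: "slope i \<noteq> s" if "i < t" for i using that by blast
  show ?thesis
  proof (cases s)
    case None
    have a: "a i \<noteq> 0" if "i < t" for i using s[OF that] None by (auto simp: slope_def)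
    define x where "x i = b i / a i" for i
    have "inj_on x {..<t}"
      using inj_on_slope a by (auto simp: inj_on_def slope_def x_def)
    then obtain \<nu> where \<nu>: "\<And>i. i \<in> {..<t} \<Longrightarrow> \<nu> i \<noteq> 0" "(\<Sum>i<t. \<nu> i) = 0"
        "(\<Sum>i<t. \<nu> i * x i) = 0" "(\<Sum>i<t. \<nu> i * (x i)\<^sup>2) = 0"
      using ex_vanishing_moment_weights[of "{..<t}" x] t by auto
    define \<mu> where "\<mu> i = \<nu> i / (a i)\<^sup>2" for i
    have "(\<Sum>i<t. \<mu> i * (a i)\<^sup>2) = (\<Sum>i<t. \<nu> i)"
      "(\<Sum>i<t. \<mu> i * (a i * b i)) = (\<Sum>i<t. \<nu> i * x i)"
      "(\<Sum>i<t. \<mu> i * (b i)\<^sup>2) = (\<Sum>i<t. \<nu> i * (x i)\<^sup>2)"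
      using a by (auto intro!: sum.cong simp: \<mu>_def x_def power2_eq_square)
    then show ?thesis using that[of \<mu>] \<nu> a by (simp add: \<mu>_def)
  next
    case (Some c)
    \<comment> \<open>This form vanishes exactly on the direction of slope c, which no column has;
      in the coordinate \<open>x = a / d\<close> one has \<open>b = d * (1 + c * x)\<close>.\<close>
    define d where "d i = b i - c * a i" for i
    have d: "d i \<noteq> 0" if "i < t" for i
    proof (cases "a i = 0")
      case True
      obtain j where "j < t" "j \<noteq> i"
        using t(1) by (cases "i = 0") (auto intro: that[of 0] that[of 1])
      then have "b i \<noteq> 0" using minor[of i j] that True by auto
      then show ?thesis using True by (simp add: d_def)
    next
      case False
      then show ?thesis using s[OF that] Some by (auto simp: slope_def d_def field_simps)
    qed
    define x where "x i = a i / d i" for i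
    have "inj_on x {..<t}"
    proof (rule inj_onI, rule ccontr)
      fix i j assume ij: "i \<in> {..<t}" "j \<in> {..<t}" and eq: "x i = x j" and "i \<noteq> j"
      then have "a i * b j - a j * b i \<noteq> 0" using minor by simp
      moreover have "a i * d j = a j * d i" using eq d ij by (simp add: x_def field_simps)
      ultimately show False by (simp add: d_def algebra_simps)
    qed
    then obtain \<nu> where \<nu>: "\<And>i. i \<in> {..<t} \<Longrightarrow> \<nu> i \<noteq> 0" "(\<Sum>i<t. \<nu> i) = 0"
        "(\<Sum>i<t. \<nu> i * x i) = 0" "(\<Sum>i<t. \<nu> i * (x i)\<^sup>2) = 0"
      using ex_vanishing_moment_weights[of "{..<t}" x] t by auto
    define \<mu> where "\<mu> i = \<nu> i / (d i)\<^sup>2" for i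
    have ab: "a i = d i * x i" "b i = d i * (1 + c * x i)" "\<mu> i * (d i * d i) = \<nu> i" if "i < t" for i
      using d[OF that] by (simp_all add: x_def \<mu>_def field_simps power2_eq_square) (simp add: d_def algebra_simps)
    have terms: "\<mu> i * (a i)\<^sup>2 = \<nu> i * (x i)\<^sup>2"
      "\<mu> i * (a i * b i) = \<nu> i * x i + c * (\<nu> i * (x i)\<^sup>2)"
      "\<mu> i * (b i)\<^sup>2 = \<nu> i + 2 * c * (\<nu> i * x i) + c\<^sup>2 * (\<nu> i * (x i)\<^sup>2)" if "i < t" for i
      unfolding ab(1,2)[OF that] ab(3)[OF that, symmetric] by (simp_all add: power2_eq_square algebra_simps)
    have "(\<Sum>i<t. \<mu> i * (a i)\<^sup>2) = (\<Sum>i<t. \<nu> i * (x i)\<^sup>2)"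
      "(\<Sum>i<t. \<mu> i * (a i * b i)) = (\<Sum>i<t. \<nu> i * x i) + c * (\<Sum>i<t. \<nu> i * (x i)\<^sup>2)"
      "(\<Sum>i<t. \<mu> i * (b i)\<^sup>2) = (\<Sum>i<t. \<nu> i) + 2 * c * (\<Sum>i<t. \<nu> i * x i) + c\<^sup>2 * (\<Sum>i<t. \<nu> i * (x i)\<^sup>2)"
      unfolding sum_distrib_left sum.distrib[symmetric]
      by (intro sum.cong refl; simp only: lessThan_iff terms)+
    then show ?thesis using that[of \<mu>] \<nu> d by (simp add: \<mu>_def)
  qed
qed

subsection \<open>Dual solutions\<close>

text \<open>Three vectors in a plane satisfy a linear relation whose coefficients are the
  complementary minors, here nonzero. The coefficient at \<open>i0\<close> is not exported because
  \<open>i0\<close> is the index absent from the dual condition.\<close>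

lemma ex_three_supported_sol:
  assumes i: "i0 < t" "i1 < t" "i2 < t" and dist: "i0 \<noteq> i1" "i1 \<noteq> i2" "i0 \<noteq> i2"
  obtains d1 d2 where "d1 \<noteq> 0" "d2 \<noteq> 0"
    "\<And>w. w \<in> carrier_vec n \<Longrightarrow> \<exists>v\<in>sol n. v i1 = d1 \<cdot>\<^sub>v w \<and> v i2 = d2 \<cdot>\<^sub>v w \<and>
      (\<forall>l<t. l \<notin> {i0, i1, i2} \<longrightarrow> v l = 0\<^sub>v n)"
proof -
  define d where "d k l = a k * b l - a l * b k" for k l
  show ?thesis
  proof (rule that[of "d i2 i0" "d i0 i1"])
    show "d i2 i0 \<noteq> 0" "d i0 i1 \<noteq> 0" using minor i dist by (auto simp: d_def)
    fix w :: "'a vec" assume w: "w \<in> carrier_vec n"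
    define e where "e l = (if l = i0 then d i1 i2 else if l = i1 then d i2 i0 else
      if l = i2 then d i0 i1 else 0)" for l
    define v where "v = (\<lambda>l\<in>{..<t}. e l \<cdot>\<^sub>v w)"
    have three: "(\<Sum>l<t. h l * e l) = h i0 * d i1 i2 + h i1 * d i2 i0 + h i2 * d i0 i1" for h
    proof -
      have "(\<Sum>l<t. h l * e l) = (\<Sum>l\<in>{i0, i1, i2}. h l * e l)"
        using i by (intro sum.mono_neutral_right) (auto simp: e_def)
      then show ?thesis using dist by (simp add: e_def)
    qed
    have lin: "(\<Sum>l<t. h l * (v l $ k)) = (\<Sum>l<t. h l * e l) * w $ k" if "k < n" for h k
      using w that by (simp add: v_def sum_distrib_right mult.assoc)
    have "(\<Sum>l<t. a l * e l) = 0" "(\<Sum>l<t. b l * e l) = 0"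
      unfolding three by (simp_all add: d_def algebra_simps)
    then have "v \<in> sol n" using w lin by (auto simp: sol_def v_def)
    moreover have "0 \<cdot>\<^sub>v w = 0\<^sub>v n" using w by (intro eq_vecI) auto
    ultimately show "\<exists>v\<in>sol n. v i1 = d i2 i0 \<cdot>\<^sub>v w \<and> v i2 = d i0 i1 \<cdot>\<^sub>v w \<and>
      (\<forall>l<t. l \<notin> {i0, i1, i2} \<longrightarrow> v l = 0\<^sub>v n)"
      using i dist by (intro bexI[of _ v]) (auto simp: v_def e_def)
  qed
qed

text \<open>The tuples u for which v \<mapsto> chr (sum of c_i (u_i . v_i)) is the trivial character
  of \<open>sol m\<close>. The condition \<open>u i \<noteq> 0\<close> reflects the cut-off of the
  quadric function at u = 0.\<close>

definition dual_sol :: "nat \<Rightarrow> nat set \<Rightarrow> (nat \<Rightarrow> 'a) \<Rightarrow> (nat \<Rightarrow> 'a vec) set" where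
  "dual_sol m S c = {u \<in> sol m. (\<forall>i\<in>S. u i \<noteq> 0\<^sub>v m) \<and>
     (\<forall>v\<in>sol m. (\<Sum>i\<in>S. c i * (u i \<bullet> v i)) = 0)}"

text \<open>Testing against solutions supported on \<open>{i0, i1, i2}\<close> involves only
  \<open>u i1\<close> and \<open>u i2\<close>, as \<open>i0\<close> is missing from the sum. So
  \<open>u i1\<close> determines every other \<open>u i2\<close>, and the two equations for u then
  leave nothing free at \<open>i0\<close>.\<close>

lemma card_dual_sol_le:
  assumes t: "t \<ge> 3" and i0: "i0 < t" and c: "\<And>i. i < t \<Longrightarrow> i \<noteq> i0 \<Longrightarrow> c i \<noteq> 0"
  shows "card (dual_sol m ({..<t} - {i0}) c) \<le> CARD('a) ^ m"
proof -
  let ?S = "{..<t} - {i0}"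
  obtain i1 where i1: "i1 < t" "i1 \<noteq> i0"
    using t by (cases "i0 = 0") (auto intro: that[of 0] that[of 1])
  have det: "u i2 = u' i2"
    if u: "u \<in> dual_sol m ?S c" "u' \<in> dual_sol m ?S c" "u i1 = u' i1" and i2: "i2 < t" "i2 \<noteq> i0" "i2 \<noteq> i1"
    for u u' i2
  proof -
    obtain d1 d2 where d: "d1 \<noteq> 0" "d2 \<noteq> 0" and
      v: "\<And>w. w \<in> carrier_vec m \<Longrightarrow> \<exists>v\<in>sol m. v i1 = d1 \<cdot>\<^sub>v w \<and> v i2 = d2 \<cdot>\<^sub>v w \<and>
        (\<forall>l<t. l \<notin> {i0, i1, i2} \<longrightarrow> v l = 0\<^sub>v m)"
      using ex_three_supported_sol[of i0 i1 i2 m] i0 i1 i2 by metis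
    have car: "u i \<in> carrier_vec m" "u' i \<in> carrier_vec m" if "i < t" for i
      using u that sol_carrier by (auto simp: dual_sol_def)
    have eq: "c i1 * (d1 * (q i1 \<bullet> w)) + c i2 * (d2 * (q i2 \<bullet> w)) = 0"
      if q: "q \<in> dual_sol m ?S c" and w: "w \<in> carrier_vec m" for q w
    proof -
      obtain v where v: "v \<in> sol m" "v i1 = d1 \<cdot>\<^sub>v w" "v i2 = d2 \<cdot>\<^sub>v w"
        "\<And>l. l < t \<Longrightarrow> l \<notin> {i0, i1, i2} \<Longrightarrow> v l = 0\<^sub>v m"
        using v[OF w] by blast
      have qc: "q i \<in> carrier_vec m" if "i < t" for i
        using q that sol_carrier by (auto simp: dual_sol_def)
      have "0 = (\<Sum>i\<in>?S. c i * (q i \<bullet> v i))" using q v(1) by (simp add: dual_sol_def)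
      also have "\<dots> = (\<Sum>i\<in>{i1, i2}. c i * (q i \<bullet> v i))"
        using i1 i2 v(4) qc by (intro sum.mono_neutral_right) auto
      also have "\<dots> = c i1 * (d1 * (q i1 \<bullet> w)) + c i2 * (d2 * (q i2 \<bullet> w))"
        using i1 i2 qc[of i1] qc[of i2] w by (simp add: v)
      finally show ?thesis by simp
    qed
    have "u i2 \<bullet> w = u' i2 \<bullet> w" if "w \<in> carrier_vec m" for w
    proof -
      have "c i2 * (d2 * (u i2 \<bullet> w)) = c i2 * (d2 * (u' i2 \<bullet> w))"
        using eq[OF u(1) that] eq[OF u(2) that] u(3) by (metis add_left_imp_eq)
      then show ?thesis using c[of i2] i2 d by simp
    qed
    then have "u i2 $ k = u' i2 $ k" if "k < m" for k
      using that car[OF i2(1)] scalar_prod_right_unit by (metis unit_vec_carrier)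
    then show ?thesis using car[OF i2(1)] by (intro eq_vecI) auto
  qed
  have "inj_on (\<lambda>u. u i1) (dual_sol m ?S c)"
  proof (rule inj_onI)
    fix u u' assume u: "u \<in> dual_sol m ?S c" "u' \<in> dual_sol m ?S c" "u i1 = u' i1"
    show "u = u'"
    proof (rule sol_eqI)
      show "u \<in> sol m" "u' \<in> sol m" using u by (auto simp: dual_sol_def)
      show "u l = u' l" if "l < t" "l \<noteq> i0" "l \<noteq> i1" for l using det[OF u that] .
    qed (use i0 i1 in auto)
  qed
  moreover have "(\<lambda>u. u i1) ` dual_sol m ?S c \<subseteq> carrier_vec m"
    using sol_carrier i1 by (auto simp: dual_sol_def)
  ultimately have "card (dual_sol m ?S c) \<le> card (carrier_vec m :: 'a vec set)"
    by (rule card_inj_on_le) simp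
  then show ?thesis by (simp add: card_carrier_vec)
qed

text \<open>For \<open>u\<^sub>i = \<mu>\<^sub>i (a\<^sub>i r + b\<^sub>i s)\<close> the two equations for \<open>u\<close> are the vanishing of the three quadratic
  moments, and the orthogonality to \<open>v\<close> is the pair of equations for \<open>v\<close>.  Fixing the first two
  coordinates of \<open>r\<close> and \<open>s\<close> makes every \<open>u\<^sub>i\<close> nonzero.\<close>

lemma card_dual_sol_ge:
  assumes t: "t \<ge> 2" and \<mu>: "\<And>i. i < t \<Longrightarrow> \<mu> i \<noteq> 0" and iso: "(\<Sum>i<t. \<mu> i * (a i)\<^sup>2) = 0"
    "(\<Sum>i<t. \<mu> i * (a i * b i)) = 0" "(\<Sum>i<t. \<mu> i * (b i)\<^sup>2) = 0"
  shows "card (dual_sol (Suc (Suc m)) {..<t} (\<lambda>i\<in>{..<t}. inverse (\<mu> i))) \<ge> (CARD('a) ^ m)\<^sup>2"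
proof -
  let ?n = "Suc (Suc m)" and ?C = "carrier_vec m :: 'a vec set"
  define R where "R r = vCons 1 (vCons 0 r)" for r :: "'a vec"
  define Q where "Q s = vCons 0 (vCons 1 s)" for s :: "'a vec"
  define u where "u = (\<lambda>(r, s). \<lambda>i\<in>{..<t}. \<mu> i \<cdot>\<^sub>v (a i \<cdot>\<^sub>v R r + b i \<cdot>\<^sub>v Q s))"
  have RQ: "R r \<in> carrier_vec ?n" "Q r \<in> carrier_vec ?n" if "r \<in> ?C" for r
    using that by (auto simp: R_def Q_def)
  have u_index: "u (r, s) i $ k = \<mu> i * (a i * R r $ k + b i * Q s $ k)"
    if "r \<in> ?C" "s \<in> ?C" "i < t" "k < ?n" for r s i k
    using that RQ[OF that(1)] RQ[OF that(2)] by (simp add: u_def)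
  have sol: "u (r, s) \<in> sol ?n" if rs: "r \<in> ?C" "s \<in> ?C" for r s
  proof -
    have "(\<Sum>i<t. a i * (u (r, s) i $ k)) = (\<Sum>i<t. \<mu> i * (a i)\<^sup>2) * R r $ k + (\<Sum>i<t. \<mu> i * (a i * b i)) * Q s $ k"
      "(\<Sum>i<t. b i * (u (r, s) i $ k)) = (\<Sum>i<t. \<mu> i * (a i * b i)) * R r $ k + (\<Sum>i<t. \<mu> i * (b i)\<^sup>2) * Q s $ k"
      if "k < ?n" for k
      unfolding sum_distrib_right sum.distrib[symmetric] using that rs
      by (auto intro!: sum.cong simp: u_index algebra_simps power2_eq_square)
    moreover have "u (r, s) \<in> {..<t} \<rightarrow>\<^sub>E carrier_vec ?n"
      using RQ[OF rs(1)] RQ[OF rs(2)] by (auto simp: u_def)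
    ultimately show ?thesis using iso by (simp add: sol_def)
  qed
  have nonzero: "u (r, s) i \<noteq> 0\<^sub>v ?n" if rs: "r \<in> ?C" "s \<in> ?C" and i: "i < t" for r s i
  proof
    assume "u (r, s) i = 0\<^sub>v ?n"
    then have "u (r, s) i $ 0 = 0" "u (r, s) i $ 1 = 0" by simp_all
    then have "a i = 0" "b i = 0"
      using u_index[OF rs i, of 0] u_index[OF rs i, of 1] \<mu>[OF i] by (simp_all add: R_def Q_def)
    moreover obtain j where "j < t" "j \<noteq> i"
      using t by (cases "i = 0") (auto intro: that[of 0] that[of 1])
    ultimately show False using minor[of i j] i by simp
  qed
  have orth: "(\<Sum>i<t. (\<lambda>i\<in>{..<t}. inverse (\<mu> i)) i * (u (r, s) i \<bullet> v i)) = 0"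
    if rs: "r \<in> ?C" "s \<in> ?C" and v: "v \<in> sol ?n" for r s v
  proof -
    have vc: "v i \<in> carrier_vec ?n" if "i < t" for i using sol_carrier[OF v that] .
    have "(\<lambda>i\<in>{..<t}. inverse (\<mu> i)) i * (u (r, s) i \<bullet> v i) =
        (\<Sum>k<?n. R r $ k * (a i * v i $ k) + Q s $ k * (b i * v i $ k))" if i: "i < t" for i
    proof -
      have "u (r, s) i \<bullet> v i = (\<Sum>k<?n. u (r, s) i $ k * v i $ k)"
        using vc[OF i] by (simp add: scalar_prod_def lessThan_atLeast0)
      also have "\<dots> = (\<Sum>k<?n. \<mu> i * (R r $ k * (a i * v i $ k) + Q s $ k * (b i * v i $ k)))"
        using rs i by (intro sum.cong refl) (simp add: u_index algebra_simps)
      finally show ?thesis using i \<mu>[OF i] by (simp flip: sum_distrib_left)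
    qed
    then have "(\<Sum>i<t. (\<lambda>i\<in>{..<t}. inverse (\<mu> i)) i * (u (r, s) i \<bullet> v i)) =
        (\<Sum>i<t. \<Sum>k<?n. R r $ k * (a i * v i $ k) + Q s $ k * (b i * v i $ k))"
      by (intro sum.cong refl) auto
    also have "\<dots> = (\<Sum>k<?n. R r $ k * (\<Sum>i<t. a i * v i $ k) + Q s $ k * (\<Sum>i<t. b i * v i $ k))"
      by (subst sum.swap) (simp only: sum.distrib sum_distrib_left)
    also have "\<dots> = 0" using v by (intro sum.neutral) (auto simp: sol_def)
    finally show ?thesis .
  qed
  have inj: "inj_on u (?C \<times> ?C)"
  proof (rule inj_onI, clarify)
    fix r s r' s' assume C: "r \<in> ?C" "s \<in> ?C" "r' \<in> ?C" "s' \<in> ?C" and eq: "u (r, s) = u (r', s')"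
    have "R r $ k = R r' $ k \<and> Q s $ k = Q s' $ k" if k: "k < ?n" for k
    proof -
      define x y where "x = R r $ k - R r' $ k" and "y = Q s $ k - Q s' $ k"
      have "a i * x + b i * y = 0" if "i < t" for i
      proof -
        have "\<mu> i * (a i * R r $ k + b i * Q s $ k) = \<mu> i * (a i * R r' $ k + b i * Q s' $ k)"
          using u_index[OF C(1,2) that k] u_index[OF C(3,4) that k] eq by metis
        then have "a i * R r $ k + b i * Q s $ k = a i * R r' $ k + b i * Q s' $ k"
          using \<mu>[OF that] by (metis mult_left_cancel)
        then have "(a i * R r $ k + b i * Q s $ k) - (a i * R r' $ k + b i * Q s' $ k) = 0" by simp
        then show ?thesis by (simp add: x_def y_def algebra_simps)
      qed
      from this[of 0] this[of 1] have "a 0 * x + b 0 * y + 0 = 0" "a 1 * x + b 1 * y + 0 = 0"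
        using t by simp_all
      then have "x = 0 \<and> y = 0"
        using cramer2[of "a 0" "b 1" "b 0" "a 1" x y 0 0] minor[of 0 1] t by (simp add: mult.commute)
      then show ?thesis by (simp add: x_def y_def)
    qed
    then have "R r = R r'" "Q s = Q s'"
      using RQ[OF C(1)] RQ[OF C(2)] RQ[OF C(3)] RQ[OF C(4)] by (auto intro!: eq_vecI)
    then show "r = r' \<and> s = s'" by (simp add: R_def Q_def)
  qed
  have "u ` (?C \<times> ?C) \<subseteq> dual_sol ?n {..<t} (\<lambda>i\<in>{..<t}. inverse (\<mu> i))"
    using sol nonzero orth by (auto simp: dual_sol_def)
  from card_mono[OF _ this] show ?thesis
    using card_image[OF inj] by (simp add: card_cartesian_product card_carrier_vec dual_sol_def power2_eq_square)
qed

end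

section \<open>Character sums over the quadric\<close>

definition chr :: "'p::prime_card mod_ring \<Rightarrow> complex" where
  "chr x = cis (2 * pi * real (nat (to_int_mod_ring x)) / real CARD('p))"

lemma chr_add: "chr (x + y) = chr x * chr (y :: 'p::prime_card mod_ring)"
proof -
  let ?p = "CARD('p)" and ?n = "\<lambda>x :: 'p mod_ring. nat (to_int_mod_ring x)"
  define w where "w = cis (2 * pi / real ?p)"
  have chr: "chr z = w ^ ?n z" for z :: "'p mod_ring"
    by (simp add: chr_def w_def DeMoivre mult.commute)
  have w: "w ^ ?p = 1" by (simp add: w_def DeMoivre)
  have red: "w ^ (k mod ?p) = w ^ k" for k
  proof -
    have "w ^ k = w ^ (?p * (k div ?p) + k mod ?p)" by simp
    also have "\<dots> = w ^ (k mod ?p)" by (simp only: power_add power_mult w) simp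
    finally show ?thesis by simp
  qed
  have "to_int_mod_ring (x + y) = (to_int_mod_ring x + to_int_mod_ring y) mod int ?p"
    by transfer simp
  moreover have "to_int_mod_ring x \<ge> 0" "to_int_mod_ring y \<ge> 0"
    using range_to_int_mod_ring[where 'a = 'p] by (metis atLeastLessThan_iff rangeI)+
  ultimately have "?n (x + y) = (?n x + ?n y) mod ?p"
    by (simp add: nat_mod_distrib nat_add_distrib)
  then show ?thesis by (simp add: chr red power_add)
qed

lemma chr_eq_1_iff: "chr (x :: 'p::prime_card mod_ring) = 1 \<longleftrightarrow> x = 0"
proof
  assume 1: "chr x = 1"
  let ?n = "nat (to_int_mod_ring x)"
  have "to_int_mod_ring x \<in> {0..<int CARD('p)}"
    using range_to_int_mod_ring[where 'a = 'p] by blast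
  then have n: "?n < CARD('p)" "to_int_mod_ring x = int ?n" by auto
  have "inj_on (\<lambda>k. cis (2 * pi * real k / real CARD('p))) {..<CARD('p)}"
    using bij_betw_roots_unity[of "CARD('p)"] by (simp add: bij_betw_def)
  from inj_onD[OF this, of ?n 0] have "?n = 0"
    using 1 n(1) by (simp add: chr_def)
  then show "x = 0" using n(2) by (metis of_nat_0 to_int_mod_ring_hom.hom_0_iff)
qed (simp add: chr_def)

lemma chr_sum: "finite A \<Longrightarrow> chr (\<Sum>i\<in>A. f i) = (\<Prod>i\<in>A. chr (f i))"
  by (induction rule: finite_induct) (simp_all add: chr_add chr_eq_1_iff)

text \<open>Reindexing by \<tau> multiplies the sum by \<open>chr c\<close>, which is not 1. Only a
  bijection is asked for, so that this serves the field, the vectors of length m and the solution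
  set alike.\<close>

lemma sum_chr_eq_0:
  assumes "bij_betw \<tau> H H" and shift: "\<And>v. v \<in> H \<Longrightarrow> \<phi> (\<tau> v) = c + \<phi> v" and "c \<noteq> 0"
  shows "(\<Sum>v\<in>H. chr (\<phi> v)) = 0"
proof -
  have "(\<Sum>v\<in>H. chr (\<phi> v)) = (\<Sum>v\<in>H. chr (\<phi> (\<tau> v)))"
    by (rule sum.reindex_bij_betw[OF assms(1), symmetric])
  also have "\<dots> = chr c * (\<Sum>v\<in>H. chr (\<phi> v))"
    by (simp add: shift chr_add sum_distrib_left)
  finally show ?thesis using assms(3) by (simp add: chr_eq_1_iff)
qed

text \<open>The Fourier expansion of p times the indicator of 0, minus 1; subtracting the mean is
  the omission of the frequency 0.\<close>

lemma sum_chr_nonzero_mult: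
  fixes z :: "'p::prime_card mod_ring"
  shows "(\<Sum>l\<in>UNIV - {0}. chr (l * z)) = (if z = 0 then of_nat CARD('p) - 1 else - 1)"
proof -
  have "(\<Sum>l\<in>UNIV. chr (l * z)) = chr (0 * z) + (\<Sum>l\<in>UNIV - {0}. chr (l * z))"
    by (rule sum.remove) auto
  moreover have "(\<Sum>l\<in>UNIV. chr (l * z)) = (if z = 0 then of_nat CARD('p) else 0)"
  proof (cases "z = 0")
    case False
    have "bij_betw (\<lambda>l. 1 + l) UNIV (UNIV :: 'p mod_ring set)"
      by (rule bij_betw_byWitness[where f' = "\<lambda>l. l - 1"]) auto
    from sum_chr_eq_0[OF this, of "\<lambda>l. l * z" z] show ?thesis
      using False by (simp add: algebra_simps)
  qed (simp add: chr_eq_1_iff[THEN iffD2])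
  ultimately show ?thesis by (auto simp: chr_eq_1_iff[THEN iffD2] eq_neg_iff_add_eq_0 add.commute)
qed

text \<open>On \<open>\<bbbF>\<^sub>p\<^sup>m \<times> \<bbbF>\<^sub>p\<^sup>m\<close> this is \<open>p\<close> times the indicator of the hyperbolic quadric minus \<open>1\<close>,
  cut off at \<open>u = 0\<close> so that its mean is exactly zero.\<close>

definition quadric_fun :: "nat \<Rightarrow> 'p::prime_card mod_ring vec \<Rightarrow> real" where
  "quadric_fun m x = (let u = vec_first x m; v = vec_last x m in
     if u = 0\<^sub>v m then 0 else if u \<bullet> v = 0 then real CARD('p) - 1 else - 1)"

lemma vec_first_append: "u \<in> carrier_vec m \<Longrightarrow> vec_first (u @\<^sub>v v) m = u"
  by (intro eq_vecI) (auto simp: vec_first_def)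

lemma vec_last_append: "v \<in> carrier_vec m \<Longrightarrow> vec_last (u @\<^sub>v v) m = v"
  by (intro eq_vecI) (auto simp: vec_last_def)

lemma quadric_fun_append:
  fixes u v :: "'p::prime_card mod_ring vec"
  assumes "u \<in> carrier_vec m" "v \<in> carrier_vec m"
  shows "complex_of_real (quadric_fun m (u @\<^sub>v v)) =
    of_bool (u \<noteq> 0\<^sub>v m) * (\<Sum>l\<in>UNIV - {0}. chr (l * (u \<bullet> v)))"
  using assms
  by (simp add: quadric_fun_def vec_first_append vec_last_append sum_chr_nonzero_mult)

lemma abs_quadric_fun_le: "\<bar>quadric_fun m (x :: 'p::prime_card mod_ring vec)\<bar> \<le> real CARD('p)"
  using prime_gt_1_nat[OF prime_card[where 'a = 'p]] by (auto simp: quadric_fun_def Let_def)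

lemma bij_betw_append_vec:
  "bij_betw (\<lambda>(u, v). u @\<^sub>v v) (carrier_vec m \<times> carrier_vec m) (carrier_vec (m + m) :: 'a vec set)"
  by (rule bij_betw_byWitness[where f' = "\<lambda>x. (vec_first x m, vec_last x m)"])
    (auto simp: vec_first_append vec_last_append)

lemma scalar_prod_translate:
  fixes u w :: "'p::prime_card mod_ring vec"
  assumes "u \<in> carrier_vec m" "w \<in> carrier_vec m" "v \<in> carrier_vec m"
  shows "l * (u \<bullet> (w + v)) = l * (u \<bullet> w) + l * (u \<bullet> v)"
  using assms by (simp add: scalar_prod_add_distrib[of _ m] distrib_left)

text \<open>The sum over v vanishes for each u separately: for u = 0 by the cut-off, otherwise
  because translating v along a nonzero coordinate of u shifts every nontrivial phase.\<close>

lemma sum_quadric_fun: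
  "(\<Sum>x\<in>carrier_vec (m + m). quadric_fun m (x :: 'p::prime_card mod_ring vec)) = 0"
proof -
  let ?C = "carrier_vec m :: 'p mod_ring vec set"
  have "(\<Sum>v\<in>?C. complex_of_real (quadric_fun m (u @\<^sub>v v))) = 0" if u: "u \<in> ?C" for u
  proof (cases "u = 0\<^sub>v m")
    case True
    then show ?thesis by (simp add: quadric_fun_append)
  next
    case False
    then obtain k where k: "k < m" "u $ k \<noteq> 0" using u by (metis carrier_vecD eq_vecI index_zero_vec)
    have bij: "bij_betw (\<lambda>v. unit_vec m k + v) ?C ?C"
      by (rule bij_betw_byWitness[where f' = "\<lambda>v. - unit_vec m k + v"])
        (auto intro!: eq_vecI)
    have "(\<Sum>v\<in>?C. chr (l * (u \<bullet> v))) = 0" if "l \<noteq> 0" for l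
      using that u k
      by (intro sum_chr_eq_0[OF bij, of _ "l * (u $ k)"]) (auto simp: scalar_prod_translate)
    then have "(\<Sum>l\<in>UNIV - {0}. \<Sum>v\<in>?C. chr (l * (u \<bullet> v))) = 0" by simp
    then show ?thesis using u False
      by (subst (asm) sum.swap) (simp add: quadric_fun_append cong: sum.cong)
  qed
  then have "(\<Sum>u\<in>?C. \<Sum>v\<in>?C. complex_of_real (quadric_fun m (u @\<^sub>v v))) = 0" by simp
  also have "(\<Sum>u\<in>?C. \<Sum>v\<in>?C. complex_of_real (quadric_fun m (u @\<^sub>v v))) =
      (\<Sum>x\<in>carrier_vec (m + m). complex_of_real (quadric_fun m (x :: 'p mod_ring vec)))"
    unfolding sum.cartesian_product
    by (subst sum.reindex_bij_betw[OF bij_betw_append_vec, symmetric]) (simp add: case_prod_beta)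
  finally show ?thesis by (simp flip: of_real_sum)
qed

section \<open>Translations and splittings of the solution set\<close>

context generic_equation_pair
begin

lemma sol_add:
  assumes "v \<in> sol n" "w \<in> sol n"
  shows "(\<lambda>i\<in>{..<t}. v i + w i) \<in> sol n"
proof -
  have "(\<Sum>i<t. h i * ((\<lambda>i\<in>{..<t}. v i + w i) i $ k)) = (\<Sum>i<t. h i * (v i $ k)) + (\<Sum>i<t. h i * (w i $ k))"
    if "k < n" for h k
    unfolding sum.distrib[symmetric]
    using that carrier_vecD[OF sol_carrier[OF assms(1)]] carrier_vecD[OF sol_carrier[OF assms(2)]]
    by (intro sum.cong refl) (simp add: distrib_left)
  then show ?thesis
    using assms sol_carrier[OF assms(1)] sol_carrier[OF assms(2)]
    unfolding sol_def by (simp add: restrict_PiE_iff)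
qed

lemma sol_minus:
  assumes "v \<in> sol n"
  shows "(\<lambda>i\<in>{..<t}. - v i) \<in> sol n"
proof -
  have "(\<Sum>i<t. h i * ((\<lambda>i\<in>{..<t}. - v i) i $ k)) = - (\<Sum>i<t. h i * (v i $ k))" if "k < n" for h k
    unfolding sum_negf[symmetric]
    using that carrier_vecD[OF sol_carrier[OF assms]] by (intro sum.cong refl) simp
  then show ?thesis
    using assms sol_carrier[OF assms] unfolding sol_def by (simp add: restrict_PiE_iff)
qed

lemma bij_betw_sol_translate:
  assumes w: "w \<in> sol n"
  shows "bij_betw (\<lambda>v. \<lambda>i\<in>{..<t}. w i + v i) (sol n) (sol n)"
proof (rule bij_betw_byWitness[where f' = "\<lambda>v. \<lambda>i\<in>{..<t}. - w i + v i"])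
  note wc = sol_carrier[OF w]
  have undef: "v i = undefined" if "v \<in> sol n" "\<not> i < t" for v i
    using that by (auto simp: sol_def PiE_iff extensional_def)
  have "- w i + (w i + v i) = v i" "w i + (- w i + v i) = v i" if "v \<in> sol n" "i < t" for v i
    using wc[OF that(2)] sol_carrier[OF that] by (auto intro!: eq_vecI)
  then show "\<forall>v\<in>sol n. (\<lambda>i\<in>{..<t}. - w i + (\<lambda>i\<in>{..<t}. w i + v i) i) = v"
    "\<forall>v\<in>sol n. (\<lambda>i\<in>{..<t}. w i + (\<lambda>i\<in>{..<t}. - w i + v i) i) = v"
    by (auto simp: fun_eq_iff restrict_def intro: undef[symmetric])
  show "(\<lambda>v. \<lambda>i\<in>{..<t}. w i + v i) ` sol n \<subseteq> sol n" using sol_add[OF w] by auto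
  have "(\<lambda>i\<in>{..<t}. - w i + v i) = (\<lambda>i\<in>{..<t}. (\<lambda>i\<in>{..<t}. - w i) i + v i)" for v
    by (rule restrict_ext) simp
  then show "(\<lambda>v. \<lambda>i\<in>{..<t}. - w i + v i) ` sol n \<subseteq> sol n" using sol_add[OF sol_minus[OF w]] by auto
qed

text \<open>The equations hold coordinatewise, so the u-halves and the v-halves are independent
  solutions. This permits summing over v with u fixed, where the phase is linear.\<close>

lemma bij_betw_sol_append:
  "bij_betw (\<lambda>(u, v). \<lambda>i\<in>{..<t}. u i @\<^sub>v v i) (sol m \<times> sol m) (sol (m + m))"
proof (rule bij_betw_byWitness[where
      f' = "\<lambda>Y. (\<lambda>i\<in>{..<t}. vec_first (Y i) m, \<lambda>i\<in>{..<t}. vec_last (Y i) m)"])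
  have undef: "v i = undefined" if "v \<in> sol n" "\<not> i < t" for v i n
    using that by (auto simp: sol_def PiE_iff extensional_def)
  show "\<forall>p\<in>sol m \<times> sol m. (\<lambda>i\<in>{..<t}. vec_first ((case p of (u, v) \<Rightarrow> \<lambda>i\<in>{..<t}. u i @\<^sub>v v i) i) m,
      \<lambda>i\<in>{..<t}. vec_last ((case p of (u, v) \<Rightarrow> \<lambda>i\<in>{..<t}. u i @\<^sub>v v i) i) m) = p"
    using sol_carrier
    by (auto simp: fun_eq_iff restrict_def vec_first_append vec_last_append intro: undef[symmetric])
  show "\<forall>Y\<in>sol (m + m). (case (\<lambda>i\<in>{..<t}. vec_first (Y i) m, \<lambda>i\<in>{..<t}. vec_last (Y i) m) of
      (u, v) \<Rightarrow> \<lambda>i\<in>{..<t}. u i @\<^sub>v v i) = Y"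
    using sol_carrier by (auto simp: fun_eq_iff restrict_def intro: undef[symmetric])
  show "(\<lambda>(u, v). \<lambda>i\<in>{..<t}. u i @\<^sub>v v i) ` (sol m \<times> sol m) \<subseteq> sol (m + m)"
  proof clarify
    fix u v assume uv: "u \<in> sol m" "v \<in> sol m"
    have idx: "(u i @\<^sub>v v i) $ k = (if k < m then u i $ k else v i $ (k - m))" if "i < t" "k < m + m" for i k
      using sol_carrier[OF uv(1) that(1)] sol_carrier[OF uv(2) that(1)] that(2) by auto
    have "(\<Sum>i<t. h i * ((\<lambda>i\<in>{..<t}. u i @\<^sub>v v i) i $ k)) =
        (if k < m then \<Sum>i<t. h i * (u i $ k) else \<Sum>i<t. h i * (v i $ (k - m)))"
      if "k < m + m" for h k
      using that by (auto simp: idx)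
    then show "(\<lambda>i\<in>{..<t}. u i @\<^sub>v v i) \<in> sol (m + m)"
      using uv sol_carrier[OF uv(1)] sol_carrier[OF uv(2)] unfolding sol_def
      by (simp add: restrict_PiE_iff)
  qed
  show "(\<lambda>Y. (\<lambda>i\<in>{..<t}. vec_first (Y i) m, \<lambda>i\<in>{..<t}. vec_last (Y i) m)) ` sol (m + m)
      \<subseteq> sol m \<times> sol m"
  proof (rule image_subsetI)
    fix Y assume Y: "Y \<in> sol (m + m)"
    have "dim_vec (Y i) = m + m" if "i < t" for i using sol_carrier[OF Y that] by simp
    then have "(\<Sum>i<t. h i * ((\<lambda>i\<in>{..<t}. vec_first (Y i) m) i $ k)) = (\<Sum>i<t. h i * (Y i $ k))"
      "(\<Sum>i<t. h i * ((\<lambda>i\<in>{..<t}. vec_last (Y i) m) i $ k)) = (\<Sum>i<t. h i * (Y i $ (m + k)))"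
      if "k < m" for h k
      using that by (auto intro!: sum.cong simp: vec_last_def vec_first_def)
    then show "(\<lambda>i\<in>{..<t}. vec_first (Y i) m, \<lambda>i\<in>{..<t}. vec_last (Y i) m) \<in> sol m \<times> sol m"
      using Y unfolding sol_def by (simp add: restrict_PiE_iff)
  qed
qed

end

text \<open>For fixed u and frequencies l the phase is additive in v, so the sum over
  \<open>v \<in> sol m\<close> is either all of \<open>sol m\<close> or zero; the first case is the
  dual condition. The right side has no negative terms, so a single l bounds it from below.\<close>

lemma sum_sol_prod_quadric_fun:
  fixes a b :: "nat \<Rightarrow> 'p::prime_card mod_ring"
  assumes "generic_equation_pair a b t" and S: "S \<subseteq> {..<t}"
  shows "(\<Sum>Y\<in>generic_equation_pair.sol a b t (m + m). \<Prod>i\<in>S. quadric_fun m (Y i)) =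
    real (card (generic_equation_pair.sol a b t m)) *
      (\<Sum>l\<in>S \<rightarrow>\<^sub>E UNIV - {0}. real (card (generic_equation_pair.dual_sol a b t m S l)))"
proof -
  interpret generic_equation_pair a b t by fact
  have fin: "finite S" using S finite_subset by blast
  let ?L = "S \<rightarrow>\<^sub>E UNIV - {0 :: 'p mod_ring}"
  let ?nz = "\<lambda>u. \<forall>i\<in>S. u i \<noteq> 0\<^sub>v m"
  define \<phi> where "\<phi> l u v = (\<Sum>i\<in>S. l i * (u i \<bullet> v i))" for l and u v :: "nat \<Rightarrow> 'p mod_ring vec"
  have inner: "(\<Sum>v\<in>sol m. chr (\<phi> l u v)) = of_nat (card (sol m)) * of_bool (\<forall>v\<in>sol m. \<phi> l u v = 0)"
    if u: "u \<in> sol m" for l u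
  proof (cases "\<forall>v\<in>sol m. \<phi> l u v = 0")
    case True
    then show ?thesis by (simp add: chr_eq_1_iff[THEN iffD2])
  next
    case False
    then obtain w where w: "w \<in> sol m" "\<phi> l u w \<noteq> 0" by blast
    have "\<phi> l u (\<lambda>i\<in>{..<t}. w i + v i) = \<phi> l u w + \<phi> l u v" if v: "v \<in> sol m" for v
      unfolding \<phi>_def sum.distrib[symmetric]
    proof (rule sum.cong[OF refl])
      fix i assume "i \<in> S"
      then have "i < t" using S by auto
      then show "l i * (u i \<bullet> (\<lambda>i\<in>{..<t}. w i + v i) i) = l i * (u i \<bullet> w i) + l i * (u i \<bullet> v i)"
        using sol_carrier[OF u] sol_carrier[OF w(1)] sol_carrier[OF v] by (simp add: scalar_prod_translate[of _ m])
    qed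
    then show ?thesis
      using sum_chr_eq_0[OF bij_betw_sol_translate[OF w(1)], of "\<phi> l u"] w False by auto
  qed
  have "complex_of_real (\<Sum>Y\<in>sol (m + m). \<Prod>i\<in>S. quadric_fun m (Y i)) =
      (\<Sum>(u, v)\<in>sol m \<times> sol m. \<Prod>i\<in>S. complex_of_real (quadric_fun m ((\<lambda>i\<in>{..<t}. u i @\<^sub>v v i) i)))"
    by (subst sum.reindex_bij_betw[OF bij_betw_sol_append, symmetric]) (simp add: case_prod_beta)
  also have "\<dots> = (\<Sum>u\<in>sol m. \<Sum>v\<in>sol m. \<Prod>i\<in>S. complex_of_real (quadric_fun m ((\<lambda>i\<in>{..<t}. u i @\<^sub>v v i) i)))"
    by (simp only: sum.cartesian_product)
  also have "\<dots> = (\<Sum>u\<in>sol m. \<Sum>v\<in>sol m. of_bool (?nz u) * (\<Sum>l\<in>?L. chr (\<phi> l u v)))"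
  proof (intro sum.cong refl)
    fix u v assume uv: "u \<in> sol m" "v \<in> sol m"
    have "(\<Prod>i\<in>S. complex_of_real (quadric_fun m ((\<lambda>i\<in>{..<t}. u i @\<^sub>v v i) i))) =
        (\<Prod>i\<in>S. of_bool (u i \<noteq> 0\<^sub>v m) * (\<Sum>l\<in>UNIV - {0}. chr (l * (u i \<bullet> v i))))"
      using S sol_carrier[OF uv(1)] sol_carrier[OF uv(2)]
      by (intro prod.cong refl) (auto simp: quadric_fun_append)
    also have "\<dots> = (\<Prod>i\<in>S. of_bool (u i \<noteq> 0\<^sub>v m)) * (\<Sum>l\<in>?L. \<Prod>i\<in>S. chr (l i * (u i \<bullet> v i)))"
      using fin by (simp add: prod.distrib prod_sum_PiE)
    also have "(\<Prod>i\<in>S. of_bool (u i \<noteq> 0\<^sub>v m)) = (of_bool (?nz u) :: complex)"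
      using fin by (cases "?nz u") (auto intro!: prod_zero)
    finally show "(\<Prod>i\<in>S. complex_of_real (quadric_fun m ((\<lambda>i\<in>{..<t}. u i @\<^sub>v v i) i))) =
        of_bool (?nz u) * (\<Sum>l\<in>?L. chr (\<phi> l u v))"
      using fin by (simp add: \<phi>_def chr_sum)
  qed
  also have "\<dots> = (\<Sum>u\<in>sol m. \<Sum>l\<in>?L. of_bool (?nz u) * (\<Sum>v\<in>sol m. chr (\<phi> l u v)))"
    by (intro sum.cong refl) (simp add: sum.swap[of _ "sol m" ?L] flip: sum_distrib_left)
  also have "\<dots> = (\<Sum>l\<in>?L. \<Sum>u\<in>sol m. of_nat (card (sol m)) * of_bool (?nz u \<and> (\<forall>v\<in>sol m. \<phi> l u v = 0)))"
    by (subst sum.swap) (auto intro!: sum.cong simp: inner)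
  also have "\<dots> = of_nat (card (sol m)) * (\<Sum>l\<in>?L. of_nat (card (dual_sol m S l)))"
  proof -
    have "(\<Sum>u\<in>sol m. of_bool (?nz u \<and> (\<forall>v\<in>sol m. \<phi> l u v = 0))) = (of_nat (card (dual_sol m S l)) :: complex)" for l
      by (simp add: dual_sol_def \<phi>_def Int_def)
    then show ?thesis by (simp only: sum_distrib_left[symmetric])
  qed
  also have "\<dots> = complex_of_real (real (card (sol m)) * (\<Sum>l\<in>?L. real (card (dual_sol m S l))))"
    by simp
  finally show ?thesis by (simp only: of_real_eq_iff)
qed

section \<open>Odd systems of at least five forms\<close>

lemma odd_deviation:
  fixes a b :: "nat \<Rightarrow> 'p::prime_card mod_ring" and \<epsilon> :: real
  assumes "generic_equation_pair a b t" and t: "odd t" "t \<ge> 4" and eps: "\<epsilon> > 0"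
  shows "\<exists>n\<ge>1. \<exists>f. (\<forall>x\<in>carrier_vec n. \<bar>f x\<bar> \<le> 1/2) \<and> (\<Sum>x\<in>carrier_vec n. f x) = 0 \<and>
      (\<Sum>Y\<in>generic_equation_pair.sol a b t n. \<Prod>i<t. 1/2 + \<epsilon> * f (Y i)) <
        (1/2) ^ t * card (generic_equation_pair.sol a b t n)"
proof -
  interpret generic_equation_pair a b t by fact
  define K where "K = real CARD('p)"
  have K: "K \<ge> 2" using prime_ge_2_nat[OF prime_card[where 'a = 'p]] by (simp add: K_def)
  \<comment> \<open>For odd p the number p + 1 is even, and for p = 2 it is 3, below the bound on
    t.\<close>
  have "t \<noteq> CARD('p) + 1"
  proof
    assume "t = CARD('p) + 1"
    then have "CARD('p) = 2"
      using t prime_odd_nat[OF prime_card[where 'a = 'p]] prime_ge_2_nat[OF prime_card[where 'a = 'p]]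
      by (cases "CARD('p) = 2") auto
    then show False using \<open>t = _\<close> t by simp
  qed
  then have "t \<le> CARD('p mod_ring)" using number_of_forms_le by simp
  then obtain \<mu> where \<mu>: "\<And>i. i < t \<Longrightarrow> \<mu> i \<noteq> 0" "(\<Sum>i<t. \<mu> i * (a i)\<^sup>2) = 0"
    "(\<Sum>i<t. \<mu> i * (a i * b i)) = 0" "(\<Sum>i<t. \<mu> i * (b i)\<^sup>2) = 0"
    using ex_isotropic_weights[OF t(2)] by blast
  define \<eta> where "\<eta> = \<epsilon> / (2 * K)"
  have eta: "\<eta> > 0" using eps K by (simp add: \<eta>_def)
  \<comment> \<open>Chosen so that \<open>\<eta> * K ^ (2 * m')\<close> beats
    \<open>t * K ^ t * K ^ m\<close>. Here \<open>m = m' + 2\<close>, because the lower bound for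
    the dual count spends two coordinates; this is the 2 in \<open>K ^ (t + 2)\<close>.\<close>
  obtain m' where m': "t * K ^ (t + 2) / \<eta> < K ^ m'"
    using real_arch_pow[of K] K by auto
  define m where "m = Suc (Suc m')"
  define M where "M S = (\<Sum>Y\<in>sol (m + m). \<Prod>i\<in>S. quadric_fun m (Y i))" for S
  have t2: "t \<ge> 2" using t by simp
  have N: "real (card (sol m)) > 0" using card_sol[OF t2, of m] by simp
  have M_le: "M ({..<t} - {i}) \<le> card (sol m) * (K ^ t * K ^ m)" if i: "i < t" for i
  proof -
    let ?S = "{..<t} - {i}"
    let ?L = "?S \<rightarrow>\<^sub>E UNIV - {0 :: 'p mod_ring}"
    have "real (card (dual_sol m ?S l)) \<le> K ^ m" if "l \<in> ?L" for l
    proof -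
      have "card (dual_sol m ?S l) \<le> CARD('p mod_ring) ^ m"
        using that t(2) i by (intro card_dual_sol_le) (auto simp: PiE_iff)
      then show ?thesis unfolding K_def by (metis CARD_mod_ring of_nat_le_iff of_nat_power)
    qed
    then have "(\<Sum>l\<in>?L. real (card (dual_sol m ?S l))) \<le> (\<Sum>l\<in>?L. K ^ m)" by (rule sum_mono)
    also have "\<dots> = real (card ?L) * K ^ m" by simp
    also have "real (card ?L) \<le> K ^ t"
    proof -
      have "card ?L = (CARD('p) - 1) ^ (t - 1)" using i by (simp add: card_PiE)
      also have "\<dots> \<le> CARD('p) ^ (t - 1)" by (rule power_mono) auto
      also have "\<dots> \<le> CARD('p) ^ t" by (rule power_increasing) (auto simp: Suc_le_eq)
      finally show ?thesis unfolding K_def by (metis of_nat_le_iff of_nat_power)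
    qed
    finally show ?thesis
      unfolding M_def using K by (subst sum_sol_prod_quadric_fun[OF assms(1)]) (auto intro!: mult_left_mono)
  qed
  have M_ge: "M {..<t} \<ge> card (sol m) * (K ^ m')\<^sup>2"
  proof -
    let ?L = "{..<t} \<rightarrow>\<^sub>E UNIV - {0 :: 'p mod_ring}"
    \<comment> \<open>This one frequency tuple, the inverses of the isotropic weights, already gives
      the required order.\<close>
    let ?l = "\<lambda>i\<in>{..<t}. inverse (\<mu> i)"
    have "(K ^ m')\<^sup>2 \<le> real (card (dual_sol m {..<t} ?l))"
    proof -
      have "(CARD('p mod_ring) ^ m')\<^sup>2 \<le> card (dual_sol m {..<t} ?l)"
        unfolding m_def using t2 \<mu> by (rule card_dual_sol_ge)
      then show ?thesis unfolding K_def by (metis CARD_mod_ring of_nat_le_iff of_nat_power)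
    qed
    also have "\<dots> \<le> (\<Sum>l\<in>?L. real (card (dual_sol m {..<t} l)))"
    proof (rule member_le_sum)
      show "?l \<in> ?L" using \<mu>(1) by (subst restrict_PiE_iff) auto
    qed (auto intro: finite_PiE)
    finally show ?thesis
      unfolding M_def by (subst sum_sol_prod_quadric_fun[OF assms(1)]) (auto intro!: mult_left_mono)
  qed
  \<comment> \<open>The divisor brings the values into [-1/2, 1/2]; the minus sign makes the full
    term, odd in \<open>f\<close>, negative.\<close>
  define f where "f x = - quadric_fun m x / (2 * K)" for x :: "'p mod_ring vec"
  have f_bound: "\<bar>f x\<bar> \<le> 1/2" for x
    using abs_quadric_fun_le[of m x] K by (simp add: f_def K_def)
  have f_sum: "(\<Sum>x\<in>carrier_vec (m + m). f x) = 0"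
    using sum_quadric_fun[of m, where 'p = 'p]
    by (simp add: f_def sum_negf flip: sum_divide_distrib)
  have ef: "\<epsilon> * f x = - \<eta> * quadric_fun m x" for x by (simp add: f_def \<eta>_def)
  have sum_ef: "(\<Sum>x\<in>carrier_vec (m + m). \<epsilon> * f x) = 0"
    using f_sum by (simp flip: sum_distrib_left)
  have M_ef: "(\<Sum>Y\<in>sol (m + m). \<Prod>i\<in>S. \<epsilon> * f (Y i)) = (- \<eta>) ^ card S * M S" for S
    unfolding ef M_def by (simp add: prod.distrib sum_distrib_left del: mult_minus_left)
  have "(\<Sum>Y\<in>sol (m + m). \<Prod>i<t. 1/2 + \<epsilon> * f (Y i)) =
      card (sol (m + m)) * (1/2) ^ t + 1/2 * (\<Sum>i<t. \<eta> ^ (t - 1) * M ({..<t} - {i})) - \<eta> ^ t * M {..<t}"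
  proof -
    have "(\<Sum>i<t. (- \<eta>) ^ card ({..<t} - {i}) * M ({..<t} - {i})) = (\<Sum>i<t. \<eta> ^ (t - 1) * M ({..<t} - {i}))"
      using t by (intro sum.cong refl) simp
    then show ?thesis
      using sum_sol_prod_add[OF t2, of "1/2 :: real" "\<lambda>x. \<epsilon> * f x" "m + m"] t card_sol[OF t2, of "m + m"]
      unfolding M_ef sum_ef by (simp add: power_0_left)
  qed
  also have "\<dots> < card (sol (m + m)) * (1/2) ^ t"
  proof -
    have "(\<Sum>i<t. \<eta> ^ (t - 1) * M ({..<t} - {i})) \<le> (\<Sum>i<t. \<eta> ^ (t - 1) * (card (sol m) * (K ^ t * K ^ m)))"
      using eta M_le by (intro sum_mono mult_left_mono) auto
    also have "\<dots> = \<eta> ^ (t - 1) * card (sol m) * (t * K ^ (t + 2)) * K ^ m'"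
      by (simp add: m_def power_add power2_eq_square)
    also have "\<dots> < \<eta> ^ (t - 1) * card (sol m) * (\<eta> * K ^ m') * K ^ m'"
    proof -
      have "t * K ^ (t + 2) < \<eta> * K ^ m'" using m' eta by (simp add: pos_divide_less_eq mult.commute)
      then show ?thesis using eta N K by (intro mult_strict_right_mono mult_strict_left_mono) auto
    qed
    also have "\<dots> = \<eta> ^ t * (card (sol m) * (K ^ m')\<^sup>2)"
      using t2 by (cases t) (simp_all add: power2_eq_square)
    also have "\<dots> \<le> \<eta> ^ t * M {..<t}" using M_ge eta by (intro mult_left_mono) auto
    finally have *: "(\<Sum>i<t. \<eta> ^ (t - 1) * M ({..<t} - {i})) < \<eta> ^ t * M {..<t}" .
    have "0 \<le> \<eta> ^ t * (card (sol m) * (K ^ m')\<^sup>2)" using eta by simp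
    also have "\<dots> \<le> \<eta> ^ t * M {..<t}" using M_ge eta by (intro mult_left_mono) auto
    finally show ?thesis using * by simp
  qed
  finally have "(\<Sum>Y\<in>sol (m + m). \<Prod>i<t. 1/2 + \<epsilon> * f (Y i)) < (1/2) ^ t * card (sol (m + m))"
    by (simp add: mult.commute)
  moreover have "m + m \<ge> 1" by (simp add: m_def)
  ultimately show ?thesis using f_bound f_sum by blast
qed

text \<open>The condition for t = 3 excludes three equal forms. There T(g) is the mean of g^3, which
  for g \<ge> 0 is at least the cube of the mean of g by convexity, so that system is locally
  Sidorenko although its equations are generic.\<close>

theorem theorem3p5:
  fixes Psi M :: "'p::prime_card mod_ring mat" and D t :: nat
  assumes system: "linear_form_system D t Psi"
    and M: "M \<in> carrier_mat 2 t" "vec_space.rank 2 M = 2"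
    and image: "Im_system Psi = mat_kernel M"
    and generic: "linearly_generic M"
    and not_constant_triple: "t = 3 \<Longrightarrow> \<exists>i<t. \<exists>j<t. row Psi i \<noteq> row Psi j"
  shows "\<not> locally_Sidorenko Psi"
proof -
  note hyps = system M(1) image generic
  have t: "t \<ge> 2" using vec_space.rank_le_nc[OF M(1)] M(2) by simp
  interpret generic_equation_pair "\<lambda>i. M $$ (0, i)" "\<lambda>i. M $$ (1, i)" t
    by (rule generic_equation_pair_rows[OF hyps])
  consider "even t" | "t = 3" | "odd t" "t \<ge> 4"
  proof -
    have "even t \<or> t = 3 \<or> odd t \<and> t \<ge> 4" using t by presburger
    then show ?thesis using that by blast
  qed
  then show ?thesis
  proof cases
    case 1
    show ?thesis
      by (rule not_locally_SidorenkoI[OF hyps]) (rule even_deviation[OF t 1])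
  next
    case 2
    have Psi: "Psi \<in> carrier_mat t D" using system by (simp add: linear_form_system_def)
    obtain i j where ij: "i < t" "j < t" "row Psi i \<noteq> row Psi j"
      using not_constant_triple[OF 2] by blast
    then obtain k where k: "k < D" "Psi $$ (i, k) \<noteq> Psi $$ (j, k)"
      using Psi by (metis carrier_matD eq_vecI index_row(1,2))
    \<comment> \<open>With n = 1 this is the k-th unit vector; form l takes the value
      \<open>Psi $$ (l, k)\<close> at it, so forms i and j differ there.\<close>
    define x where "x = (\<lambda>l\<in>{..<D}. vec 1 (\<lambda>_. if l = k then 1 else 0 :: 'p mod_ring))"
    let ?Y = "\<lambda>i\<in>{..<t}. form_action Psi 1 i x"
    have "x \<in> {..<D} \<rightarrow>\<^sub>E carrier_vec 1" by (auto simp: x_def)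
    then have "?Y \<in> sol 1"
      using bij_betw_forms_sol[OF hyps, of 1] by (auto simp: bij_betw_def)
    moreover have "?Y l $ 0 = Psi $$ (l, k)" if "l < t" for l
      using that k(1) Psi by (simp add: form_action_def x_def if_distrib cong: if_cong)
    then have "?Y i \<noteq> ?Y j" using ij k(2) by metis
    ultimately have "\<exists>Y\<in>sol 1. \<exists>i<t. \<exists>j<t. Y i \<noteq> Y j" using ij by blast
    then show ?thesis
      by (intro not_locally_SidorenkoI[OF hyps] three_deviation[OF 2])
  next
    case 3
    show ?thesis
      by (rule not_locally_SidorenkoI[OF hyps])
        (rule odd_deviation[OF generic_equation_pair_rows[OF hyps] 3])
  qed
qed

end
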